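(* Let $W:[0,1]\to\mathbb C$ be $(\sigma_*,2)$-Gevrey regular, $0<\sigma<\sigma_*$, $\delta>0$ and $s\in\mathbb C$. Suppose $u\in H^2(I)$ has support in $[\delta,1]$, vanishes at $x=1$ in the trace sense, and satisfies $\mathcal L_su=f$ for some $f\in Y^\sigma$. Then $u\in X^\sigma$ and $\|u\|_{X^\sigma}\le C(\|f\|_{Y^\sigma}+\|u\|_{L^2(I)})$ for a constant $C$ depending on $\sigma,\delta,s,W$ but not on $u$ or $f$.
   Context: Let $I=(0,1)$. A function $u\in C^\infty(\overline I)$ is $(\sigma,k)$-Gevrey regular ($\sigma,k>0$) if there is $C>0$ with $\sup_{x\in I}|u^{(n)}(x)|\le C\sigma^{-n}(n!)^k$ for all $n\ge0$. For $\sigma>0$, $u\in C^\infty(\overline I)$, $k\in\{0,1,2\}$: $|u|^{0}_{\sigma,k,0}=\big(\sum_{n=0}^\infty\frac{\sigma^{2n}}{n!^2(n+1)!^2}n^{k}\int_0^1(x/\sigma)^k|\partial_x^nu|^2dx\big)^{1/2}$ (with $0^0:=1$), $\|u\|_{\sigma,0,0}=|u|^0_{\sigma,0,0}$, $[u]^0_\sigma=(\sum_{n=0}^\infty\frac{\sigma^{2n+1}}{n!^2(n+1)!^2}|u^{(n)}(0)|^2)^{1/2}$. $X^\sigma=\{u\in C^\infty(\overline I):u(1)=0,\ \|\partial_xu\|_{\sigma,0,0}+|\partial_xu|^0_{\sigma,1,0}+|\partial_xu|^0_{\sigma,2,0}+[\partial_xu]^0_\sigma<\infty\}$, $Y^\sigma=\{u\in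 C^\infty(\overline I):\|u\|_{\sigma,0,0}+|u|^0_{\sigma,1,0}+[u]^0_\sigma<\infty\}$, with norms $\|u\|_{X^\sigma}=(\|\partial_xu\|_{\sigma,0,0}^2+(|\partial_xu|^0_{\sigma,1,0})^2+(|\partial_xu|^0_{\sigma,2,0})^2+([\partial_xu]^0_\sigma)^2)^{1/2}$, $\|u\|_{Y^\sigma}=(\|u\|_{\sigma,0,0}^2+(|u|^0_{\sigma,1,0})^2+([u]^0_\sigma)^2)^{1/2}$. $\mathcal L_su=\frac{d}{dx}(x^2\frac{du}{dx})+s\frac{du}{dx}-Wu$. *)

theory Defs
  imports "HOL-Analysis.Analysis"
begin

abbreviation I_open :: "real set" where "I_open \<equiv> {0<..<1}"
abbreviation I_closed :: "real set" where "I_closed \<equiv> {0..1}"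

fun nderiv :: "nat \<Rightarrow> (real \<Rightarrow> complex) \<Rightarrow> real \<Rightarrow> complex" where
  "nderiv 0 u = u"
| "nderiv (Suc n) u = (\<lambda>x. vector_derivative (nderiv n u) (at x within I_closed))"

definition smooth_I :: "(real \<Rightarrow> complex) \<Rightarrow> bool" where
  "smooth_I u \<longleftrightarrow> (\<forall>n. \<forall>x\<in>I_closed.
      (nderiv n u has_vector_derivative nderiv (Suc n) u x) (at x within I_closed))"

definition gevrey :: "real \<Rightarrow> real \<Rightarrow> (real \<Rightarrow> complex) \<Rightarrow> bool" where
  "gevrey \<sigma> k u \<longleftrightarrow> smooth_I u \<and>
     (\<exists>C>0. \<forall>n. \<forall>x\<in>I_open. cmod (nderiv n u x) \<le> C * \<sigma> powr (- real n) * (fact n) powr k)"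

text \<open>Terms of the weighted norm |u|^0_{\<sigma>,k,0} (squared norm = sum of the terms); 0^0 = 1.\<close>
definition semi_term :: "real \<Rightarrow> nat \<Rightarrow> (real \<Rightarrow> complex) \<Rightarrow> nat \<Rightarrow> real" where
  "semi_term \<sigma> k u n = \<sigma> ^ (2*n) / ((fact n)^2 * (fact (n+1))^2) * (real n) ^ k *
      integral I_closed (\<lambda>x. (x / \<sigma>) ^ k * (cmod (nderiv n u x))^2)"

definition semi_norm :: "real \<Rightarrow> nat \<Rightarrow> (real \<Rightarrow> complex) \<Rightarrow> real" where
  "semi_norm \<sigma> k u = sqrt (\<Sum>n. semi_term \<sigma> k u n)"

definition trace_term :: "real \<Rightarrow> (real \<Rightarrow> complex) \<Rightarrow> nat \<Rightarrow> real" where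
  "trace_term \<sigma> u n = \<sigma> ^ (2*n+1) / ((fact n)^2 * (fact (n+1))^2) * (cmod (nderiv n u 0))^2"

definition trace_norm :: "real \<Rightarrow> (real \<Rightarrow> complex) \<Rightarrow> real" where
  "trace_norm \<sigma> u = sqrt (\<Sum>n. trace_term \<sigma> u n)"

text \<open>Membership in X^\<sigma> and Y^\<sigma> (the series have nonnegative terms, so finiteness = summability).\<close>
definition in_X :: "real \<Rightarrow> (real \<Rightarrow> complex) \<Rightarrow> bool" where
  "in_X \<sigma> u \<longleftrightarrow> smooth_I u \<and> u 1 = 0 \<and>
     summable (semi_term \<sigma> 0 (nderiv 1 u)) \<and> summable (semi_term \<sigma> 1 (nderiv 1 u)) \<and>
     summable (semi_term \<sigma> 2 (nderiv 1 u)) \<and> summable (trace_term \<sigma> (nderiv 1 u))"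

definition norm_X :: "real \<Rightarrow> (real \<Rightarrow> complex) \<Rightarrow> real" where
  "norm_X \<sigma> u = sqrt ((semi_norm \<sigma> 0 (nderiv 1 u))^2 + (semi_norm \<sigma> 1 (nderiv 1 u))^2
      + (semi_norm \<sigma> 2 (nderiv 1 u))^2 + (trace_norm \<sigma> (nderiv 1 u))^2)"

definition in_Y :: "real \<Rightarrow> (real \<Rightarrow> complex) \<Rightarrow> bool" where
  "in_Y \<sigma> u \<longleftrightarrow> smooth_I u \<and>
     summable (semi_term \<sigma> 0 u) \<and> summable (semi_term \<sigma> 1 u) \<and> summable (trace_term \<sigma> u)"

definition norm_Y :: "real \<Rightarrow> (real \<Rightarrow> complex) \<Rightarrow> real" where
  "norm_Y \<sigma> u = sqrt ((semi_norm \<sigma> 0 u)^2 + (semi_norm \<sigma> 1 u)^2 + (trace_norm \<sigma> u)^2)"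

definition L2_I :: "(real \<Rightarrow> complex) \<Rightarrow> bool" where
  "L2_I u \<longleftrightarrow> set_borel_measurable lebesgue I_open u \<and>
     set_integrable lebesgue I_open (\<lambda>x. (cmod (u x))^2)"

definition L2_norm :: "(real \<Rightarrow> complex) \<Rightarrow> real" where
  "L2_norm u = sqrt (LINT x:I_open|lebesgue. (cmod (u x))^2)"

definition test_fun :: "(real \<Rightarrow> real) \<Rightarrow> bool" where
  "test_fun \<phi> \<longleftrightarrow> (\<forall>n x. ((deriv ^^ n) \<phi> has_real_derivative (deriv ^^ Suc n) \<phi> x) (at x)) \<and>
     (\<exists>a b. 0 < a \<and> b < 1 \<and> (\<forall>x. x \<notin> {a..b} \<longrightarrow> \<phi> x = 0))"

definition weak_deriv :: "(real \<Rightarrow> complex) \<Rightarrow> (real \<Rightarrow> complex) \<Rightarrow> bool" where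
  "weak_deriv u v \<longleftrightarrow> (\<forall>\<phi>. test_fun \<phi> \<longrightarrow>
     set_integrable lebesgue I_open (\<lambda>x. u x * complex_of_real (deriv \<phi> x)) \<and>
     set_integrable lebesgue I_open (\<lambda>x. v x * complex_of_real (\<phi> x)) \<and>
     (LINT x:I_open|lebesgue. u x * complex_of_real (deriv \<phi> x)) =
       - (LINT x:I_open|lebesgue. v x * complex_of_real (\<phi> x)))"

definition H2_I :: "(real \<Rightarrow> complex) \<Rightarrow> bool" where
  "H2_I u \<longleftrightarrow> L2_I u \<and> (\<exists>v1 v2. L2_I v1 \<and> L2_I v2 \<and> weak_deriv u v1 \<and> weak_deriv v1 v2)"

definition L_op_eq :: "complex \<Rightarrow> (real \<Rightarrow> complex) \<Rightarrow> (real \<Rightarrow> complex) \<Rightarrow> (real \<Rightarrow> complex) \<Rightarrow> bool" where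
  "L_op_eq s W u f \<longleftrightarrow> (\<exists>v g. weak_deriv u v \<and> weak_deriv (\<lambda>x. complex_of_real (x^2) * v x) g \<and>
     (AE x in lebesgue. x \<in> I_open \<longrightarrow> g x + s * v x - W x * u x = f x))"

definition trace_zero_at_1 :: "(real \<Rightarrow> complex) \<Rightarrow> bool" where
  "trace_zero_at_1 u \<longleftrightarrow> (\<exists>w. continuous_on I_closed w \<and>
     (AE x in lebesgue. x \<in> I_open \<longrightarrow> w x = u x) \<and> w 1 = 0)"

end

theory Submission
  imports Defs
begin

text \<open>
  The trace condition provides a continuous representative \<open>w\<close> of \<open>u\<close>. Eliminating the weak
  derivatives, the equation says that the continuous function \<open>x\<^sup>2 w + \<integral>(s w - 2 t w - H)\<close>, with
  \<open>H = \<integral>(f + W w)\<close>, has vanishing second distributional derivative and hence is affine. So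
  \<open>x\<^sup>2 w' = D + H - s w\<close>; since \<open>w = 0\<close> on \<open>[0, \<delta>)\<close>, division by \<open>x\<^sup>2\<close> is harmless, and \<open>w\<close> is
  smooth by bootstrapping.

  On \<open>[\<delta>, 1]\<close> the \<open>n\<close>-th derivative of the equation bounds \<open>w\<^sup>(\<^sup>n\<^sup>+\<^sup>2\<^sup>)\<close> by lower derivatives. After
  weighting, the leading step gains a factor \<open>1/n\<close> and the contribution of \<open>W\<close> is a convolution with
  \<open>\<rho>\<^sup>n\<close>, \<open>\<rho> = \<sigma>/\<sigma>\<^sub>* < 1\<close>. The geometrically weighted partial sums of the squared norms therefore
  satisfy \<open>T\<^sub>n\<^sub>+\<^sub>1 \<le> (\<rho> + K/n\<^sup>2) T\<^sub>n + K \<Phi>\<^sub>n\<close>, which contracts for large \<open>n\<close>; the initial term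
  \<open>\<parallel>w'\<parallel>\<close> is controlled by Gronwall's inequality starting from \<open>w' = 0\<close> near 0.
\<close>

section \<open>Finitely often differentiable functions\<close>

text \<open>The weights leave just enough room for the seminorm with \<open>k = 2\<close>. Writing
  \<open>w^(n+2)\<close> in terms of \<open>z_(n+2)\<close> brings a factor
  \<open>(n+1)^2 (n+2)^2\<close>, while differentiating \<open>x^2 w'' + 2 x w'\<close> only
  produces the coefficients \<open>2 (n+1)\<close> and \<open>n (n+1)\<close>. If \<open>z_j\<close>
  is given an additional factor \<open>j + 1\<close>, one power of \<open>n\<close> is still left
  over; squared, it is the \<open>n^2\<close> of that seminorm. Strictness of \<sigma> <
  \<open>\<sigma>s\<close> makes the geometric weights summable, so that Cauchy-Schwarz costs only
  \<open>1 / (1 - \<rho>)\<close> and the convolution survives squaring and integration. The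
  recursion reaches orders 2 and higher only. Order 0 is the L2 norm of \<open>u\<close>, and order
  1 has to be supplied separately, which is the purpose of the Gronwall argument. Finiteness of the
  norms of \<open>w\<close> is a conclusion, so all bounds are proved for partial sums, and
  constants are fixed before the sequences; hence the recursive inequalities are stated for
  arbitrary sequences. On the weak side, the derivatives are known only through integrals against
  test functions, so they are eliminated before any pointwise argument.\<close>

fun times_differentiable_on :: "nat \<Rightarrow> (real \<Rightarrow> 'a::real_normed_field) \<Rightarrow> real set \<Rightarrow> bool" where
  "times_differentiable_on 0 f S = True"
| "times_differentiable_on (Suc n) f S =
     (\<exists>f'. (\<forall>x\<in>S. (f has_vector_derivative f' x) (at x within S)) \<and> times_differentiable_on n f' S)"

lemma times_differentiable_on_SucI:
  assumes "\<And>x. x \<in> S \<Longrightarrow> (f has_vector_derivative f' x) (at x within S)"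
    "times_differentiable_on n f' S"
  shows "times_differentiable_on (Suc n) f S"
  using assms by auto

lemma times_differentiable_on_SucE:
  assumes "times_differentiable_on (Suc n) f S"
  obtains f' where "\<And>x. x \<in> S \<Longrightarrow> (f has_vector_derivative f' x) (at x within S)"
    "times_differentiable_on n f' S"
  using assms unfolding times_differentiable_on.simps by blast

lemma times_differentiable_on_cong:
  assumes "\<And>x. x \<in> S \<Longrightarrow> f x = g x" "times_differentiable_on n f S"
  shows "times_differentiable_on n g S"
proof (cases n)
  case (Suc m)
  then obtain f' where f': "\<forall>x\<in>S. (f has_vector_derivative f' x) (at x within S)"
    "times_differentiable_on m f' S" using assms(2) by auto
  have "(g has_vector_derivative f' x) (at x within S)" if "x \<in> S" for x
    using f'(1) assms(1) that by (metis has_vector_derivative_transform)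
  then show ?thesis using Suc f'(2) by auto
qed auto

lemma times_differentiable_on_SucD:
  "times_differentiable_on (Suc n) f S \<Longrightarrow> times_differentiable_on n f S"
proof (induction n arbitrary: f)
  case (Suc n)
  then show ?case by (metis times_differentiable_on.simps(2))
qed auto

lemma times_differentiable_on_const: "times_differentiable_on n (\<lambda>x. c) S"
proof (induction n arbitrary: c)
  case (Suc n)
  then show ?case
    by (intro times_differentiable_on_SucI[where f' = "\<lambda>x. 0"] has_vector_derivative_const)
qed auto

lemma times_differentiable_on_of_real: "times_differentiable_on n of_real S"
proof (cases n)
  case (Suc m)
  have "(of_real has_vector_derivative (1::'a)) (at x within S)" for x
    using has_vector_derivative_of_real[OF DERIV_ident, of "at x within S"] by simp
  then show ?thesis unfolding Suc
    by (rule times_differentiable_on_SucI[OF _ times_differentiable_on_const])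
qed auto

lemma times_differentiable_on_add:
  assumes "times_differentiable_on n f S" "times_differentiable_on n g S"
  shows "times_differentiable_on n (\<lambda>x. f x + g x) S"
  using assms
proof (induction n arbitrary: f g)
  case (Suc n)
  then obtain f' g' where "\<forall>x\<in>S. (f has_vector_derivative f' x) (at x within S)"
    "times_differentiable_on n f' S" "\<forall>x\<in>S. (g has_vector_derivative g' x) (at x within S)"
    "times_differentiable_on n g' S" by auto
  then show ?case
    by (intro times_differentiable_on_SucI[where f' = "\<lambda>x. f' x + g' x"]
        has_vector_derivative_add Suc.IH) simp_all
qed auto

lemma times_differentiable_on_mult:
  assumes "times_differentiable_on n f S" "times_differentiable_on n g S"
  shows "times_differentiable_on n (\<lambda>x. f x * g x) S"
  using assms
proof (induction n arbitrary: f g)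
  case (Suc n)
  then obtain f' g' where d: "\<forall>x\<in>S. (f has_vector_derivative f' x) (at x within S)"
    "times_differentiable_on n f' S" "\<forall>x\<in>S. (g has_vector_derivative g' x) (at x within S)"
    "times_differentiable_on n g' S" by auto
  have "times_differentiable_on n f S" "times_differentiable_on n g S"
    using Suc.prems times_differentiable_on_SucD by metis+
  then show ?case using d
    by (intro times_differentiable_on_SucI[where f' = "\<lambda>x. f x * g' x + f' x * g x"]
        has_vector_derivative_mult times_differentiable_on_add Suc.IH) simp_all
qed auto

lemma times_differentiable_on_cmult:
  "times_differentiable_on n f S \<Longrightarrow> times_differentiable_on n (\<lambda>x. c * f x) S"
  by (intro times_differentiable_on_mult times_differentiable_on_const)

lemma times_differentiable_on_diff:
  assumes "times_differentiable_on n f S" "times_differentiable_on n g S"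
  shows "times_differentiable_on n (\<lambda>x. f x - g x) S"
  using times_differentiable_on_add[OF assms(1) times_differentiable_on_cmult[OF assms(2), of "-1"]]
  by simp

lemma times_differentiable_on_affine:
  assumes "times_differentiable_on n f UNIV"
  shows "times_differentiable_on n (\<lambda>x. f (c * x + d)) UNIV"
  using assms
proof (induction n arbitrary: f)
  case (Suc n)
  then obtain f' where d: "\<And>x. (f has_vector_derivative f' x) (at x)"
    "times_differentiable_on n f' UNIV" by auto
  have "((\<lambda>x. f (c * x + d)) has_vector_derivative (of_real c * f' (c * x + d))) (at x)" for x
  proof -
    have "((\<lambda>x. c * x + d) has_vector_derivative c) (at x)"
      by (auto intro!: derivative_eq_intros)
    from vector_diff_chain_at[OF this d(1)] show ?thesis
      by (simp add: o_def scaleR_conv_of_real)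
  qed
  moreover have "times_differentiable_on n (\<lambda>x. of_real c * f' (c * x + d)) UNIV"
    by (intro times_differentiable_on_cmult Suc.IH d(2))
  ultimately show ?case
    by (auto simp del: times_differentiable_on.simps
        intro!: times_differentiable_on_SucI[where f' = "\<lambda>x. of_real c * f' (c * x + d)"])
qed auto

section \<open>Test functions\<close>

text \<open>\<open>times_differentiable_on\<close> only asserts that some chain of derivatives
  exists, so sums, products and quotients are handled by short inductions without computing iterated
  derivatives. This equivalence makes those closure rules available for test functions.\<close>

lemma test_fun_iff:
  "test_fun \<phi> \<longleftrightarrow> (\<forall>n. times_differentiable_on n \<phi> UNIV) \<and>
     (\<exists>a b. 0 < a \<and> b < 1 \<and> (\<forall>x. x \<notin> {a..b} \<longrightarrow> \<phi> x = 0))"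
proof -
  have 1: "times_differentiable_on n ((deriv ^^ m) \<phi>) UNIV"
    if "\<forall>n x. ((deriv ^^ n) \<phi> has_real_derivative (deriv ^^ Suc n) \<phi> x) (at x)" for n m
  proof (induction n arbitrary: m)
    case (Suc n)
    have "((deriv ^^ m) \<phi> has_vector_derivative (deriv ^^ Suc m) \<phi> x) (at x)" for x
      using that by (simp add: has_real_derivative_iff_has_vector_derivative)
    then show ?case using Suc.IH[of "Suc m"] by auto
  qed auto
  have 2: "times_differentiable_on m ((deriv ^^ n) \<phi>) UNIV"
    if "\<forall>n. times_differentiable_on n \<phi> UNIV" for n m
  proof (induction n arbitrary: m)
    case (Suc n)
    obtain f' where f': "\<And>x. ((deriv ^^ n) \<phi> has_vector_derivative f' x) (at x)"
      "times_differentiable_on m f' UNIV" using Suc[of "Suc m"] by auto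
    \<comment> \<open>The chains for different orders are unrelated as witnesses; uniqueness of
      derivatives identifies each of them with the iterates of \<open>deriv\<close>.\<close>
    have "(deriv ^^ Suc n) \<phi> = f'"
      using f'(1) by (auto simp flip: has_real_derivative_iff_has_vector_derivative intro!: DERIV_imp_deriv)
    then show ?case using f'(2) by simp
  qed (use that in auto)
  have 3: "((deriv ^^ n) \<phi> has_real_derivative (deriv ^^ Suc n) \<phi> x) (at x)"
    if "\<forall>n. times_differentiable_on n \<phi> UNIV" for n x
  proof -
    have "times_differentiable_on (Suc 0) ((deriv ^^ n) \<phi>) UNIV" by (intro 2 that)
    then obtain f' where f': "\<And>x. ((deriv ^^ n) \<phi> has_vector_derivative f' x) (at x)" by auto
    then have "((deriv ^^ n) \<phi> has_real_derivative f' x) (at x)"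
      by (simp add: has_real_derivative_iff_has_vector_derivative)
    then show ?thesis by (simp add: DERIV_imp_deriv)
  qed
  show ?thesis unfolding test_fun_def using 1[where m = 0] 3 by auto
qed

lemma test_fun_has_real_derivative:
  "test_fun \<phi> \<Longrightarrow> (\<phi> has_real_derivative deriv \<phi> x) (at x)"
  unfolding test_fun_def by (metis comp_apply funpow.simps(2) funpow_0 id_apply)

lemma continuous_on_test_fun: "test_fun \<phi> \<Longrightarrow> continuous_on S \<phi>"
  using test_fun_has_real_derivative
  by (meson DERIV_isCont continuous_at_imp_continuous_on)

lemma test_fun_deriv:
  assumes "test_fun \<phi>" shows "test_fun (deriv \<phi>)"
proof -
  obtain a b where ab: "0 < a" "b < 1" "\<forall>x. x \<notin> {a..b} \<longrightarrow> \<phi> x = 0"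
    using assms unfolding test_fun_def by blast
  have "deriv \<phi> x = 0" if "x \<notin> {a..b}" for x
  proof -
    have "((\<lambda>x. 0) has_real_derivative deriv \<phi> x) (at x)"
    proof (rule has_field_derivative_transform_within_open[OF test_fun_has_real_derivative[OF assms]])
      show "open (- {a..b})" "x \<in> - {a..b}" using that by auto
    qed (use ab in auto)
    then show ?thesis by (metis DERIV_const DERIV_unique)
  qed
  moreover have "((deriv ^^ n) (deriv \<phi>) has_real_derivative (deriv ^^ Suc n) (deriv \<phi>) x) (at x)" for n x
    using assms unfolding test_fun_def by (metis funpow_Suc_right comp_apply)
  ultimately show ?thesis unfolding test_fun_def using ab by blast
qed

lemma test_fun_diff_cmult:
  assumes "test_fun \<phi>" "test_fun \<psi>" shows "test_fun (\<lambda>x. \<phi> x - c * \<psi> x)"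
proof -
  obtain a b a' b' where ab: "0 < a" "b < 1" "\<forall>x. x \<notin> {a..b} \<longrightarrow> \<phi> x = 0"
    "0 < a'" "b' < 1" "\<forall>x. x \<notin> {a'..b'} \<longrightarrow> \<psi> x = 0"
    using assms unfolding test_fun_def by metis
  have "\<exists>a b. 0 < a \<and> b < 1 \<and> (\<forall>x. x \<notin> {a..b} \<longrightarrow> \<phi> x - c * \<psi> x = 0)"
  proof (intro exI conjI allI impI)
    fix x assume "x \<notin> {min a a'..max b b'}"
    then have "x \<notin> {a..b}" "x \<notin> {a'..b'}" by auto
    then show "\<phi> x - c * \<psi> x = 0" using ab by simp
  qed (use ab in auto)
  moreover have "times_differentiable_on n (\<lambda>x. \<phi> x - c * \<psi> x) UNIV" for n
    using assms unfolding test_fun_iff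
    by (intro times_differentiable_on_diff times_differentiable_on_cmult) auto
  ultimately show ?thesis unfolding test_fun_iff by blast
qed

lemma test_fun_mult:
  assumes "\<And>n. times_differentiable_on n p UNIV" "test_fun \<phi>"
  shows "test_fun (\<lambda>x. p x * \<phi> x)"
proof -
  obtain a b where ab: "0 < a" "b < 1" "\<forall>x. x \<notin> {a..b} \<longrightarrow> \<phi> x = 0"
    using assms unfolding test_fun_def by blast
  have "times_differentiable_on n \<phi> UNIV" for n using assms(2) unfolding test_fun_iff by blast
  then have "times_differentiable_on n (\<lambda>x. p x * \<phi> x) UNIV" for n
    by (intro times_differentiable_on_mult assms(1))
  moreover have "\<forall>x. x \<notin> {a..b} \<longrightarrow> p x * \<phi> x = 0" using ab by simp
  with ab have "\<exists>a b. 0 < a \<and> b < 1 \<and> (\<forall>x. x \<notin> {a..b} \<longrightarrow> p x * \<phi> x = 0)" by blast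
  ultimately show ?thesis unfolding test_fun_iff by blast
qed

text \<open>The primitive starting at 0 vanishes to the left of the support because the integrand
  does, and to the right of it because the total integral is 0. The mean-zero condition is thus what
  keeps the support compact.\<close>

lemma test_fun_antideriv:
  assumes \<psi>: "test_fun \<psi>" and 0: "integral {0..1} \<psi> = 0"
  obtains \<phi> where "test_fun \<phi>" "\<And>x. (\<phi> has_real_derivative \<psi> x) (at x)"
proof -
  define \<phi> where "\<phi> x = integral {0..x} \<psi>" for x
  obtain a b where ab: "0 < a" "b < 1" "\<forall>x. x \<notin> {a..b} \<longrightarrow> \<psi> x = 0"
    using \<psi> unfolding test_fun_def by blast
  have int: "\<psi> integrable_on {c..d}" for c d
    by (intro integrable_continuous_real continuous_on_test_fun \<psi>)
  have low: "\<phi> x = 0" if "x < a" for x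
  proof -
    have "\<phi> x = integral {0..x} (\<lambda>x. 0)" unfolding \<phi>_def
      by (rule integral_cong) (use ab that in auto)
    then show ?thesis by simp
  qed
  have high: "\<phi> x = 0" if "x > b" "x \<ge> a" for x
  proof (cases "x \<le> 1")
    case True
    have "integral {x..1} \<psi> = integral {x..1} (\<lambda>x. 0)"
      by (rule integral_cong) (use ab that in auto)
    then show ?thesis using Henstock_Kurzweil_Integration.integral_combine[of 0 x 1 \<psi>] int 0 True that ab
      unfolding \<phi>_def by auto
  next
    case False
    have "integral {1..x} \<psi> = integral {1..x} (\<lambda>x. 0)"
      by (rule integral_cong) (use ab that in auto)
    then show ?thesis using Henstock_Kurzweil_Integration.integral_combine[of 0 1 x \<psi>] int 0 False
      unfolding \<phi>_def by auto
  qed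
  have d: "(\<phi> has_real_derivative \<psi> x) (at x)" for x
  proof (cases "x < a")
    case True
    have "(\<phi> has_real_derivative 0) (at x)"
      by (rule has_field_derivative_transform_within_open[where f = "\<lambda>x. 0" and S = "{..<a}"])
        (use True low in auto)
    then show ?thesis using ab True by auto
  next
    case False
    \<comment> \<open>The fundamental theorem of calculus only yields a derivative within an
      interval; here \<open>x \<ge> a > 0\<close> lies in the interior of
      \<open>{0..x+1}\<close>.\<close>
    have "(\<phi> has_real_derivative \<psi> x) (at x within {0..x+1})" unfolding \<phi>_def
      by (rule integral_has_real_derivative) (use continuous_on_test_fun[OF \<psi>] False ab in auto)
    moreover have "at x within {0..x+1} = at x"
      by (rule at_within_interior) (use False ab in auto)
    ultimately show ?thesis by simp
  qed
  have "times_differentiable_on n \<phi> UNIV" for n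
  proof (cases n)
    case (Suc m)
    then show ?thesis using d \<psi> unfolding test_fun_iff
      by (auto simp: has_real_derivative_iff_has_vector_derivative)
  qed auto
  moreover have "\<phi> x = 0" if "x \<notin> {a..b}" for x
    using low[of x] high[of x] that by (cases "x < a") auto
  ultimately have "test_fun \<phi>" unfolding test_fun_iff using ab by blast
  then show ?thesis using d that by blast
qed

text \<open>The standard flat function \<open>exp (-1/x)\<close> is embedded in a family indexed by
  \<open>k\<close> because the span of the family is closed under differentiation; smoothness at 0
  then follows by one induction for all \<open>k\<close> simultaneously.\<close>

definition flat :: "nat \<Rightarrow> real \<Rightarrow> real" where
  "flat k x = (if x > 0 then exp (- 1 / x) / x ^ k else 0)"

text \<open>The exponential series of \<open>1/x\<close> is bounded below by its single term of
  order \<open>k + 2\<close>. The surplus of two powers makes the difference quotient of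
  \<open>flat k\<close> at 0 of order \<open>\<bar>h\<bar>\<close>.\<close>

lemma abs_flat_le: "\<bar>flat k x\<bar> \<le> fact (k + 2) * x\<^sup>2"
proof (cases "x > 0")
  case True
  have "(1/x) ^ (k+2) / fact (k+2) \<le> exp (1/x)"
  proof -
    have "(\<lambda>n. inverse (fact n) *\<^sub>R (1/x) ^ n) sums exp (1/x)" by (rule exp_converges)
    then have "sum (\<lambda>n. inverse (fact n) *\<^sub>R (1/x) ^ n) {k+2} \<le> exp (1/x)"
      using sum_le_suminf[OF sums_summable, of _ _ "{k+2}"] sums_unique True by fastforce
    then show ?thesis by (simp add: field_simps)
  qed
  then have "exp (-1/x) * (1 / x ^ (k+2) / fact (k+2)) \<le> exp (-1/x) * exp (1/x)"
    by (intro mult_left_mono) (auto simp: power_one_over)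
  also have "\<dots> = 1" by (simp flip: exp_add)
  finally have "exp (-1/x) \<le> fact (k+2) * x ^ (k+2)"
    using True by (simp add: divide_simps mult.commute del: fact_Suc power_Suc)
  then have "exp (-1/x) / x ^ k \<le> fact (k+2) * x ^ (k+2) / x ^ k"
    using True by (intro divide_right_mono) auto
  also have "\<dots> = fact (k+2) * x\<^sup>2" using True by (simp add: power_add power2_eq_square del: fact_Suc)
  finally show ?thesis using True by (simp add: flat_def)
qed (auto simp: flat_def)

lemma flat_has_real_derivative:
  "(flat k has_real_derivative flat (k + 2) x - real k * flat (k + 1) x) (at x)"
proof -
  consider "x > 0" | "x < 0" | "x = 0" by linarith
  then show ?thesis
  proof cases
    case 1
    have "((\<lambda>x. exp (- 1 / x) / x ^ k) has_real_derivative flat (k + 2) x - real k * flat (k + 1) x) (at x)"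
    proof (cases k)
      case (Suc m)
      have "((\<lambda>x. exp (- 1 / x) / x ^ Suc m) has_real_derivative
          (exp (- 1 / x) * (1 / x\<^sup>2) * x ^ Suc m - exp (- 1 / x) * (real (Suc m) * x ^ m)) / (x ^ Suc m * x ^ Suc m)) (at x)"
        using 1 by (auto intro!: derivative_eq_intros simp: power2_eq_square simp del: power_Suc)
      moreover have "(exp (- 1 / x) * (1 / x\<^sup>2) * x ^ Suc m - exp (- 1 / x) * (real (Suc m) * x ^ m)) / (x ^ Suc m * x ^ Suc m)
         = flat (k + 2) x - real k * flat (k + 1) x"
        using 1 Suc by (simp add: flat_def field_simps power2_eq_square)
      ultimately show ?thesis using Suc by simp
    qed (use 1 in \<open>auto intro!: derivative_eq_intros simp: flat_def field_simps power2_eq_square\<close>)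
    then show ?thesis
      by (rule has_field_derivative_transform_within_open[where S = "{0<..}"]) (use 1 in \<open>auto simp: flat_def\<close>)
  next
    case 2
    have "((\<lambda>x. 0) has_real_derivative flat (k + 2) x - real k * flat (k + 1) x) (at x)"
      using 2 by (simp add: flat_def)
    then show ?thesis
      by (rule has_field_derivative_transform_within_open[where S = "{..<0}"]) (use 2 in \<open>auto simp: flat_def\<close>)
  next
    case 3
    have "((\<lambda>h. flat k h / h) \<longlongrightarrow> 0) (at 0)"
    proof (rule Lim_null_comparison)
      have "norm (flat k h / h) \<le> fact (k+2) * \<bar>h\<bar>" if "h \<noteq> 0" for h
      proof -
        have "\<bar>flat k h\<bar> \<le> fact (k+2) * \<bar>h\<bar> * \<bar>h\<bar>"
          using abs_flat_le[of k h] by (simp only: power2_abs[of h, symmetric] power2_eq_square mult.assoc)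
        then show ?thesis using that by (simp add: pos_divide_le_eq del: fact_Suc)
      qed
      then show "\<forall>\<^sub>F h in at 0. norm (flat k h / h) \<le> fact (k+2) * \<bar>h\<bar>"
        by (auto simp: eventually_at_filter)
      have "((\<lambda>h::real. fact (k+2) * \<bar>h\<bar>) \<longlongrightarrow> fact (k+2) * \<bar>0\<bar>) (at 0)"
        by (intro tendsto_intros)
      then show "((\<lambda>h::real. fact (k+2) * \<bar>h\<bar>) \<longlongrightarrow> 0) (at 0)" by simp
    qed
    then show ?thesis using 3 by (simp add: DERIV_def flat_def)
  qed
qed

lemma times_differentiable_on_flat: "times_differentiable_on n (flat k) UNIV"
proof (induction n arbitrary: k)
  case (Suc n)
  have "times_differentiable_on n (\<lambda>x. flat (k + 2) x - real k * flat (k + 1) x) UNIV"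
    by (intro times_differentiable_on_diff times_differentiable_on_cmult Suc)
  moreover have "(flat k has_vector_derivative flat (k + 2) x - real k * flat (k + 1) x) (at x)" for x
    using flat_has_real_derivative has_real_derivative_iff_has_vector_derivative by blast
  ultimately show ?case
    by (auto simp del: times_differentiable_on.simps
        intro!: times_differentiable_on_SucI[where f' = "\<lambda>x. flat (k + 2) x - real k * flat (k + 1) x"])
qed auto

definition bump :: "real \<Rightarrow> real \<Rightarrow> real \<Rightarrow> real" where
  "bump a b x = flat 0 (x - a) * flat 0 (b - x)"

lemma test_fun_bump:
  assumes "0 < a" "b < 1" shows "test_fun (bump a b)"
proof -
  have "times_differentiable_on n (\<lambda>x. flat 0 (1 * x + - a) * flat 0 (- 1 * x + b)) UNIV" for n
    by (rule times_differentiable_on_mult;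
        rule times_differentiable_on_affine; rule times_differentiable_on_flat)
  then have "times_differentiable_on n (bump a b) UNIV" for n
    by (rule times_differentiable_on_cong[rotated]) (simp add: bump_def)
  moreover have "\<forall>x. x \<notin> {a..b} \<longrightarrow> bump a b x = 0" by (auto simp: bump_def flat_def)
  ultimately show ?thesis unfolding test_fun_iff using assms by blast
qed

lemma bump_nonneg: "bump a b x \<ge> 0"
  and bump_pos: "x \<in> {a<..<b} \<Longrightarrow> bump a b x > 0"
  and bump_outside: "x \<notin> {a..b} \<Longrightarrow> bump a b x = 0"
  by (auto simp: bump_def flat_def)

section \<open>The fundamental lemma of the calculus of variations\<close>

text \<open>If \<open>r x0\<close> were positive, a bump supported where \<open>r\<close> stays
  positive would give a nonnegative continuous integrand with integral 0, which would then vanish at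
  \<open>x0\<close>. The one-sided form is applied to both \<open>r\<close> and \<open>- r\<close>
  afterwards.\<close>

lemma fundamental_lemma_real:
  fixes r :: "real \<Rightarrow> real"
  assumes cont: "continuous_on {0..1} r"
    and int0: "\<And>\<psi>. test_fun \<psi> \<Longrightarrow> integral {0..1} (\<lambda>x. r x * \<psi> x) = 0"
    and x0: "x0 \<in> {0<..<1}"
  shows "r x0 \<le> 0"
proof (rule ccontr)
  assume neg: "\<not> r x0 \<le> 0"
  have "continuous (at x0 within {0..1}) r"
    using cont x0 by (auto simp: continuous_on_eq_continuous_within)
  then obtain e where e: "e > 0" "\<And>x. x \<in> {0..1} \<Longrightarrow> dist x x0 < e \<Longrightarrow> dist (r x) (r x0) < r x0"
    unfolding continuous_within_eps_delta using neg
    by (metis dist_commute not_le)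
  \<comment> \<open>The three bounds keep the bump where \<open>r\<close> is positive and its
    support strictly inside the unit interval.\<close>
  define d where "d = Min {e / 2, x0 / 2, (1 - x0) / 2}"
  have d: "d > 0" "d < e" "d < x0" "d < 1 - x0"
    using e(1) x0 by (auto simp: d_def min_def)
  define \<psi> where "\<psi> = bump (x0 - d) (x0 + d)"
  have \<psi>: "test_fun \<psi>" unfolding \<psi>_def by (rule test_fun_bump) (use d in auto)
  have nonneg: "0 \<le> r x * \<psi> x" if "x \<in> {0..1}" for x
  proof (cases "x \<in> {x0 - d..x0 + d}")
    case True
    then have "dist x x0 < e" using d by (auto simp: dist_real_def)
    then have "r x > 0" using e(2)[OF that] by (auto simp: dist_real_def)
    then show ?thesis using bump_nonneg by (simp add: \<psi>_def)
  qed (simp add: \<psi>_def bump_outside)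
  have "continuous_on {0..1} (\<lambda>x. r x * \<psi> x)"
    by (intro continuous_intros cont continuous_on_test_fun \<psi>)
  then have "r x0 * \<psi> x0 = 0"
    using integral_eq_0_iff[of 0 1 "\<lambda>x. r x * \<psi> x"] int0[OF \<psi>] nonneg x0 by auto
  then show False using neg bump_pos[of x0 "x0 - d" "x0 + d"] d by (simp add: \<psi>_def)
qed

lemma integrable_on_mult_test_fun:
  fixes r :: "real \<Rightarrow> complex"
  assumes "continuous_on {0..1} r" "test_fun \<psi>"
  shows "(\<lambda>x. r x * complex_of_real (\<psi> x)) integrable_on {0..1}"
  by (intro integrable_continuous_real continuous_intros assms continuous_on_test_fun)

text \<open>Test functions are real-valued, so real and imaginary parts decouple. The endpoints are
  not seen by test functions and follow by continuity.\<close>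

lemma fundamental_lemma_complex:
  fixes r :: "real \<Rightarrow> complex"
  assumes cont: "continuous_on {0..1} r"
    and int0: "\<And>\<psi>. test_fun \<psi> \<Longrightarrow> integral {0..1} (\<lambda>x. r x * complex_of_real (\<psi> x)) = 0"
    and x: "x \<in> {0..1}"
  shows "r x = 0"
proof -
  have hi: "((\<lambda>x. r x * complex_of_real (\<psi> x)) has_integral 0) {0..1}" if "test_fun \<psi>" for \<psi>
    using integrable_on_mult_test_fun[OF cont that] int0[OF that] by (metis integrable_integral)
  have re: "((\<lambda>x. Re (r x) * \<psi> x) has_integral 0) {0..1}"
    and im: "((\<lambda>x. Im (r x) * \<psi> x) has_integral 0) {0..1}" if "test_fun \<psi>" for \<psi>
    using has_integral_Re[OF hi[OF that]] has_integral_Im[OF hi[OF that]] by simp_all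
  have zero: "r y = 0" if y: "y \<in> {0<..<1}" for y
  proof -
    have le: "g y \<le> 0" "- g y \<le> 0" if "continuous_on {0..1} g"
      "\<And>\<psi>. test_fun \<psi> \<Longrightarrow> ((\<lambda>x. g x * \<psi> x) has_integral 0) {0..1}" for g
    proof -
      show "g y \<le> 0"
        using that by (intro fundamental_lemma_real[OF _ _ y]) (auto intro: integral_unique)
      have "integral {0..1} (\<lambda>x. - g x * \<psi> x) = 0" if "test_fun \<psi>" for \<psi>
        using integral_unique[OF \<open>\<And>\<psi>. test_fun \<psi> \<Longrightarrow> ((\<lambda>x. g x * \<psi> x) has_integral 0) {0..1}\<close>[OF that]]
        by simp
      then show "- g y \<le> 0"
        using that(1) by (intro fundamental_lemma_real[of "\<lambda>x. - g x", OF _ _ y]) (auto intro: continuous_intros)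
    qed
    show ?thesis
      using le[of "\<lambda>x. Re (r x)", OF _ re] le[of "\<lambda>x. Im (r x)", OF _ im] cont
      by (simp add: complex_eq_iff continuous_on_Re continuous_on_Im)
  qed
  have "closure {0<..<1} = {0..(1::real)}" by simp
  then show ?thesis
    using continuous_constant_on_closure[of "{0<..<1}" r 0 x] cont zero x by auto
qed

lemma integration_by_parts_test_fun:
  fixes F h :: "real \<Rightarrow> complex"
  assumes F: "\<And>x. x \<in> {0..1} \<Longrightarrow> (F has_vector_derivative h x) (at x within {0..1})"
    and h: "continuous_on {0..1} h" and \<phi>: "test_fun \<phi>"
  shows "integral {0..1} (\<lambda>x. h x * complex_of_real (\<phi> x)) =
    - integral {0..1} (\<lambda>x. F x * complex_of_real (deriv \<phi> x))"
proof -
  have cF: "continuous_on {0..1} F"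
    using F has_vector_derivative_continuous continuous_on_eq_continuous_within by blast
  have "((\<lambda>x. F x * complex_of_real (deriv \<phi> x) + h x * complex_of_real (\<phi> x)) has_integral
      F 1 * complex_of_real (\<phi> 1) - F 0 * complex_of_real (\<phi> 0)) {0..1}"
  proof (rule fundamental_theorem_of_calculus)
    fix x :: real assume "x \<in> {0..1}"
    have "((\<lambda>x. complex_of_real (\<phi> x)) has_vector_derivative complex_of_real (deriv \<phi> x)) (at x within {0..1})"
      using test_fun_has_real_derivative[OF \<phi>]
      by (intro has_vector_derivative_of_real) (rule has_field_derivative_at_within)
    then show "((\<lambda>x. F x * complex_of_real (\<phi> x)) has_vector_derivative
      F x * complex_of_real (deriv \<phi> x) + h x * complex_of_real (\<phi> x)) (at x within {0..1})"
      by (intro has_vector_derivative_mult F \<open>x \<in> {0..1}\<close>)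
  qed simp
  moreover have "\<phi> 0 = 0" "\<phi> 1 = 0" using \<phi> unfolding test_fun_def by auto
  ultimately have "integral {0..1} (\<lambda>x. F x * complex_of_real (deriv \<phi> x) + h x * complex_of_real (\<phi> x)) = 0"
    by (simp add: integral_unique)
  then show ?thesis
    using integral_add[OF integrable_on_mult_test_fun[OF cF test_fun_deriv[OF \<phi>]]
        integrable_on_mult_test_fun[OF h \<phi>]]
    by (simp add: eq_neg_iff_add_eq_0 add.commute)
qed

text \<open>Subtracting suitable multiples of a normalised bump \<open>\<eta>\<close> and of \<open>\<eta>'\<close> turns an
  arbitrary test function into a second derivative of a test function.\<close>

lemma second_weak_derivative_zero_imp_affine:
  fixes r :: "real \<Rightarrow> complex"
  assumes cont: "continuous_on {0..1} r"
    and int0: "\<And>\<phi>. test_fun \<phi> \<Longrightarrow>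
      integral {0..1} (\<lambda>x. r x * complex_of_real (deriv (deriv \<phi>) x)) = 0"
  shows "\<exists>C D. \<forall>x\<in>{0..1}. r x = C + D * complex_of_real x"
proof -
  define J where "J p \<psi> = integral {0..1} (\<lambda>x. p x * complex_of_real (\<psi> x))" for p :: "real \<Rightarrow> complex" and \<psi>
  define b where "b = bump (1/4) (3/4)"
  have b: "test_fun b" unfolding b_def by (rule test_fun_bump) auto
  have "integral {0..1} b \<noteq> 0"
  proof
    assume "integral {0..1} b = 0"
    then have "b (1/2) = 0" using integral_eq_0_iff[of 0 1 b] continuous_on_test_fun[OF b] bump_nonneg
      by (auto simp: b_def)
    then show False using bump_pos[of "1/2" "1/4" "3/4"] by (simp add: b_def)
  qed
  define m where "m = integral {0..1} b"
  define \<eta> where "\<eta> x = (1/m) * b x" for x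
  have \<eta>: "test_fun \<eta>" unfolding \<eta>_def
    by (rule test_fun_mult[OF times_differentiable_on_const b])
  have \<eta>1: "integral {0..1} \<eta> = 1" using \<open>integral {0..1} b \<noteq> 0\<close> unfolding \<eta>_def
    by (simp add: m_def)
  have int_of_real: "complex_of_real (integral {0..1} \<psi>) = J (\<lambda>x. 1) \<psi>" if "test_fun \<psi>" for \<psi>
  proof -
    have "\<psi> integrable_on {0..1}"
      by (intro integrable_continuous_real continuous_on_test_fun that)
    then show ?thesis unfolding J_def
      using integral_linear[of \<psi> "{0..1}" complex_of_real, OF _ bounded_linear_of_real] by (simp add: o_def)
  qed
  have Jdiff: "J p (\<lambda>x. \<psi> x - c * \<theta> x) = J p \<psi> - of_real c * J p \<theta>"
    if "continuous_on {0..1} p" "test_fun \<psi>" "test_fun \<theta>" for p \<psi> \<theta> c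
  proof -
    have "J p (\<lambda>x. \<psi> x - c * \<theta> x)
      = integral {0..1} (\<lambda>x. p x * complex_of_real (\<psi> x) - of_real c * (p x * complex_of_real (\<theta> x)))"
      unfolding J_def by (simp add: algebra_simps)
    also have "\<dots> = J p \<psi> - of_real c * J p \<theta>" unfolding J_def
      using that by (subst integral_diff) (auto intro!: integrable_on_mult_right integrable_on_mult_test_fun)
    finally show ?thesis .
  qed
  \<comment> \<open>Unravelling the two corrections of \<psi> carried out below gives
    \<open>J r \<psi> = C * J 1 \<psi> - A * J x \<psi>\<close> for every test function \<psi>;
    \<open>C\<close> and \<open>- A\<close> are read off from this identity.\<close>
  define X where "X = J (\<lambda>x. of_real x) \<eta>"
  define A where "A = J r (deriv \<eta>)"
  define C where "C = J r \<eta> + X * A"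
  define q where "q x = r x - (C + (- A) * of_real x)" for x
  have cq: "continuous_on {0..1} q" unfolding q_def by (intro continuous_intros cont)
  have "J q \<psi> = 0" if \<psi>: "test_fun \<psi>" for \<psi>
  proof -
    define a where "a = integral {0..1} \<psi>"
    define \<psi>1 where "\<psi>1 x = \<psi> x - a * \<eta> x" for x
    have \<psi>1: "test_fun \<psi>1" unfolding \<psi>1_def by (rule test_fun_diff_cmult[OF \<psi> \<eta>])
    have "complex_of_real (integral {0..1} \<psi>1) = 0"
      using int_of_real[OF \<psi>1] int_of_real[OF \<psi>] int_of_real[OF \<eta>] Jdiff[of "\<lambda>x. 1" \<psi> \<eta> a] \<psi> \<eta> \<eta>1
      by (simp add: \<psi>1_def[abs_def] a_def)
    then have "integral {0..1} \<psi>1 = 0" by simp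
    then obtain \<phi>1 where \<phi>1: "test_fun \<phi>1" "\<And>x. (\<phi>1 has_real_derivative \<psi>1 x) (at x)"
      using test_fun_antideriv[OF \<psi>1] by blast
    define c where "c = integral {0..1} \<phi>1"
    define \<psi>2 where "\<psi>2 x = \<phi>1 x - c * \<eta> x" for x
    have \<psi>2: "test_fun \<psi>2" unfolding \<psi>2_def by (rule test_fun_diff_cmult[OF \<phi>1(1) \<eta>])
    have "complex_of_real (integral {0..1} \<psi>2) = 0"
      using int_of_real[OF \<psi>2] int_of_real[OF \<phi>1(1)] int_of_real[OF \<eta>] Jdiff[of "\<lambda>x. 1" \<phi>1 \<eta> c] \<phi>1(1) \<eta> \<eta>1
      by (simp add: \<psi>2_def[abs_def] c_def)
    then have "integral {0..1} \<psi>2 = 0" by simp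
    then obtain \<phi>2 where \<phi>2: "test_fun \<phi>2" "\<And>x. (\<phi>2 has_real_derivative \<psi>2 x) (at x)"
      using test_fun_antideriv[OF \<psi>2] by blast
    have d1: "deriv \<phi>1 = \<psi>1" and d2: "deriv \<phi>2 = \<psi>2"
      using \<phi>1(2) \<phi>2(2) DERIV_imp_deriv by blast+
    have "deriv \<psi>2 x = \<psi>1 x - c * deriv \<eta> x" for x
      unfolding \<psi>2_def[abs_def]
      by (rule DERIV_imp_deriv)
        (auto intro!: derivative_eq_intros \<phi>1(2) test_fun_has_real_derivative[OF \<eta>])
    then have dd: "deriv (deriv \<phi>2) = (\<lambda>x. \<psi>1 x - c * deriv \<eta> x)" unfolding d2 by blast
    have "0 = J r \<psi>1 - of_real c * A"
      using int0[OF \<phi>2(1)] Jdiff[OF cont \<psi>1 test_fun_deriv[OF \<eta>], of c] unfolding dd A_def by (simp add: J_def)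
    moreover have "J r \<psi>1 = J r \<psi> - of_real a * J r \<eta>"
      using Jdiff[OF cont \<psi> \<eta>, of a] by (simp add: \<psi>1_def[abs_def])
    \<comment> \<open>Integration by parts against the function \<open>x\<close> turns the integral
      of the primitive \<open>\<phi>1\<close> into minus the first moment of \<open>\<psi>1\<close>.
      This is the source of the linear term.\<close>
    moreover have "of_real c = - (J (\<lambda>x. of_real x) \<psi> - of_real a * X)"
    proof -
      have "((\<lambda>x. complex_of_real x) has_vector_derivative 1) (at x within {0..1})" for x
        using has_vector_derivative_of_real[OF DERIV_ident, of "at x within {0..1}"] by simp
      then have "J (\<lambda>x. 1) \<phi>1 = - J (\<lambda>x. of_real x) \<psi>1"
        using integration_by_parts_test_fun[of "\<lambda>x. of_real x" "\<lambda>x. 1" \<phi>1] \<phi>1(1)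
        unfolding J_def d1 by simp
      moreover have "J (\<lambda>x. of_real x) \<psi>1 = J (\<lambda>x. of_real x) \<psi> - of_real a * X"
        using Jdiff[of "\<lambda>x. of_real x" \<psi> \<eta> a] \<psi> \<eta> unfolding X_def
        by (simp add: \<psi>1_def[abs_def] continuous_intros)
      ultimately show ?thesis using int_of_real[OF \<phi>1(1)] by (simp add: c_def)
    qed
    moreover have "of_real a = J (\<lambda>x. 1) \<psi>" using int_of_real[OF \<psi>] by (simp add: a_def)
    moreover have "J q \<psi> = J r \<psi> - (C * J (\<lambda>x. 1) \<psi> + (- A) * J (\<lambda>x. of_real x) \<psi>)"
    proof -
      have "J q \<psi> = integral {0..1} (\<lambda>x. r x * of_real (\<psi> x) -
          (C * (1 * of_real (\<psi> x)) + (- A) * (of_real x * of_real (\<psi> x))))"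
        unfolding J_def q_def by (simp add: algebra_simps)
      also have "\<dots> = J r \<psi> - (C * J (\<lambda>x. 1) \<psi> + (- A) * J (\<lambda>x. of_real x) \<psi>)" unfolding J_def
        by (subst integral_diff integral_add integral_mult_right;
            (intro integrable_add integrable_on_mult_right integrable_on_mult_test_fun continuous_intros cont \<psi>)?)+
          (simp only: integral_mult_right)
      finally show ?thesis .
    qed
    ultimately show ?thesis by (simp add: C_def algebra_simps)
  qed
  then have "\<forall>x\<in>{0..1}. q x = 0"
    using fundamental_lemma_complex[OF cq] unfolding J_def by blast
  then show ?thesis unfolding q_def by (metis eq_iff_diff_eq_0)
qed

section \<open>Weak solutions are classical solutions\<close>

text \<open>Weak derivatives are phrased with Lebesgue integrals, while the calculus on the unit
  interval uses the gauge integral. The passage between them also exchanges \<open>u\<close> for its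
  continuous representative.\<close>

lemma set_lebesgue_integral_eq_integral_AE:
  fixes g h :: "real \<Rightarrow> 'a::euclidean_space"
  assumes "set_integrable lebesgue {0<..<1} g"
    and "AE x in lebesgue. x \<in> {0<..<1} \<longrightarrow> g x = h x"
  shows "(LINT x:{0<..<1}|lebesgue. g x) = integral {0..1} h"
proof -
  obtain N where N: "N \<in> null_sets lebesgue" "{x \<in> space lebesgue. \<not> (x \<in> {0<..<1} \<longrightarrow> g x = h x)} \<subseteq> N"
    using assms(2) unfolding eventually_ae_filter by blast
  then have "negligible N" by (simp add: negligible_iff_null_sets)
  have "(LINT x:{0<..<1}|lebesgue. g x) = integral {0<..<1} g"
    by (rule set_lebesgue_integral_eq_integral(2)[OF assms(1)])
  also have "\<dots> = integral {0<..<1} h"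
    by (rule integral_spike[OF \<open>negligible N\<close>]) (use N(2) in auto)
  also have "\<dots> = integral {0..1} h" by (simp add: integral_open_interval_real)
  finally show ?thesis .
qed

text \<open>\<open>x\<^sup>2 \<phi>'\<close> is itself a test function: testing \<open>v\<close>
  with it equals, up to sign, testing \<open>x\<^sup>2 v\<close> with \<open>\<phi>'\<close>, and
  hence testing \<open>g\<close> with \<phi>. The equation then replaces \<open>g\<close>, and the
  remaining \<open>v\<close> goes back to \<open>w\<close> by its own definition.\<close>

lemma weak_solution_identity:
  fixes W f u w :: "real \<Rightarrow> complex"
  assumes ae: "AE x in lebesgue. x \<in> {0<..<1} \<longrightarrow> w x = u x"
    and eq: "L_op_eq s W u f" and \<phi>: "test_fun \<phi>"
  shows "integral {0..1} (\<lambda>x. w x * complex_of_real (2 * x * deriv \<phi> x + x\<^sup>2 * deriv (deriv \<phi>) x)) =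
    integral {0..1} (\<lambda>x. (f x + W x * w x) * complex_of_real (\<phi> x)) +
    s * integral {0..1} (\<lambda>x. w x * complex_of_real (deriv \<phi> x))"
proof -
  obtain v g where v: "weak_deriv u v" and g: "weak_deriv (\<lambda>x. complex_of_real (x^2) * v x) g"
    and e: "AE x in lebesgue. x \<in> {0<..<1} \<longrightarrow> g x + s * v x - W x * u x = f x"
    using eq unfolding L_op_eq_def by blast
  define \<theta> where "\<theta> x = x\<^sup>2 * deriv \<phi> x" for x
  have \<theta>: "test_fun \<theta>" unfolding \<theta>_def
  proof (rule test_fun_mult[OF _ test_fun_deriv[OF \<phi>]])
    show "times_differentiable_on n power2 UNIV" for n
      using times_differentiable_on_mult[OF times_differentiable_on_of_real times_differentiable_on_of_real,
          where 'a = real] by (simp add: power2_eq_square[abs_def])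
  qed
  have d\<theta>: "deriv \<theta> x = 2 * x * deriv \<phi> x + x\<^sup>2 * deriv (deriv \<phi>) x" for x
    unfolding \<theta>_def[abs_def]
    by (rule DERIV_imp_deriv)
      (auto intro!: derivative_eq_intros test_fun_has_real_derivative[OF test_fun_deriv[OF \<phi>]])
  have uw: "(LINT x:{0<..<1}|lebesgue. u x * complex_of_real (deriv \<psi> x)) =
      integral {0..1} (\<lambda>x. w x * complex_of_real (deriv \<psi> x))" if "test_fun \<psi>" for \<psi>
    by (rule set_lebesgue_integral_eq_integral_AE)
      (use v ae that in \<open>auto simp: weak_deriv_def elim!: eventually_mono\<close>)
  let ?V = "\<lambda>x. v x * complex_of_real (\<phi> x)" and ?G = "\<lambda>x. g x * complex_of_real (\<phi> x)"
  have iV: "set_integrable lebesgue {0<..<1} ?V" and iG: "set_integrable lebesgue {0<..<1} ?G"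
    using v g \<phi> by (auto simp: weak_deriv_def)
  have "integral {0..1} (\<lambda>x. w x * complex_of_real (deriv \<theta> x)) =
      - (LINT x:{0<..<1}|lebesgue. v x * complex_of_real (\<theta> x))"
    using uw[OF \<theta>] v \<theta> by (simp add: weak_deriv_def)
  also have "\<dots> = - (LINT x:{0<..<1}|lebesgue. complex_of_real (x^2) * v x * complex_of_real (deriv \<phi> x))"
    by (simp add: \<theta>_def mult_ac)
  also have "\<dots> = (LINT x:{0<..<1}|lebesgue. ?G x)"
    using g \<phi> by (simp add: weak_deriv_def)
  finally have 1: "integral {0..1} (\<lambda>x. w x * complex_of_real (deriv \<theta> x)) = (LINT x:{0<..<1}|lebesgue. ?G x)" .
  have 2: "integral {0..1} (\<lambda>x. w x * complex_of_real (deriv \<phi> x)) = - (LINT x:{0<..<1}|lebesgue. ?V x)"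
    using uw[OF \<phi>] v \<phi> by (simp add: weak_deriv_def)
  have "(LINT x:{0<..<1}|lebesgue. ?G x + s * ?V x) = integral {0..1} (\<lambda>x. (f x + W x * w x) * complex_of_real (\<phi> x))"
  proof (rule set_lebesgue_integral_eq_integral_AE)
    show "set_integrable lebesgue {0<..<1} (\<lambda>x. ?G x + s * ?V x)"
      by (intro set_integral_add(1) iG set_integrable_mult_right iV)
    show "AE x in lebesgue. x \<in> {0<..<1} \<longrightarrow> ?G x + s * ?V x = (f x + W x * w x) * complex_of_real (\<phi> x)"
      using e ae
    proof eventually_elim
      case (elim x)
      then have "x \<in> {0<..<1} \<longrightarrow> f x + W x * w x = g x + s * v x" by (auto simp: algebra_simps)
      then show ?case by (auto simp: algebra_simps)
    qed
  qed
  moreover have "(LINT x:{0<..<1}|lebesgue. ?G x + s * ?V x) =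
      (LINT x:{0<..<1}|lebesgue. ?G x) + s * (LINT x:{0<..<1}|lebesgue. ?V x)"
    using set_integral_add(2)[OF iG set_integrable_mult_right[OF iV, of s]] by simp
  ultimately show ?thesis using 1 2 unfolding d\<theta> by (simp add: algebra_simps)
qed

text \<open>Only \<open>x\<^sup>2 w\<close> gains a derivative here, since the equation degenerates
  at 0. The constant \<open>D\<close> is the slope of the affine function that arises from a
  vanishing second weak derivative.\<close>

lemma weak_solution_differentiable:
  fixes W f u w :: "real \<Rightarrow> complex"
  assumes W: "continuous_on {0..1} W" and f: "continuous_on {0..1} f" and w: "continuous_on {0..1} w"
    and ae: "AE x in lebesgue. x \<in> {0<..<1} \<longrightarrow> w x = u x"
    and eq: "L_op_eq s W u f"
  shows "\<exists>D. \<forall>x\<in>{0..1}. ((\<lambda>x. complex_of_real (x\<^sup>2) * w x) has_vector_derivative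
    D + integral {0..x} (\<lambda>t. f t + W t * w t) - s * w x + 2 * of_real x * w x) (at x within {0..1})"
proof -
  define h where "h x = f x + W x * w x" for x
  define H where "H x = integral {0..x} h" for x
  \<comment> \<open>After integrating \<open>h\<close> by parts, the weak identity says that
    \<open>x\<^sup>2 w\<close> tested with \<open>\<phi>''\<close> equals \<open>k\<close> tested
    with \<open>\<phi>'\<close>. A further integration by parts turns the latter into
    \<open>- M\<close> tested with \<open>\<phi>''\<close>.\<close>
  define k where "k x = s * w x - 2 * of_real x * w x - H x" for x
  define M where "M x = integral {0..x} k" for x
  have ch: "continuous_on {0..1} h" unfolding h_def by (intro continuous_intros W f w)
  have dH: "(H has_vector_derivative h x) (at x within {0..1})" if "x \<in> {0..1}" for x
    unfolding H_def by (rule integral_has_vector_derivative[OF ch that])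
  then have cH: "continuous_on {0..1} H"
    using has_vector_derivative_continuous continuous_on_eq_continuous_within by blast
  have ck: "continuous_on {0..1} k" unfolding k_def by (intro continuous_intros w cH)
  have dM: "(M has_vector_derivative k x) (at x within {0..1})" if "x \<in> {0..1}" for x
    unfolding M_def by (rule integral_has_vector_derivative[OF ck that])
  then have cM: "continuous_on {0..1} M"
    using has_vector_derivative_continuous continuous_on_eq_continuous_within by blast
  define r where "r x = complex_of_real (x\<^sup>2) * w x + M x" for x
  have cr: "continuous_on {0..1} r" unfolding r_def by (intro continuous_intros w cM)
  have "\<exists>C D. \<forall>x\<in>{0..1}. r x = C + D * complex_of_real x"
  proof (rule second_weak_derivative_zero_imp_affine[OF cr])
    fix \<phi> assume \<phi>: "test_fun \<phi>"
    have \<phi>': "test_fun (deriv \<phi>)" and \<phi>'': "test_fun (deriv (deriv \<phi>))"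
      using \<phi> test_fun_deriv by blast+
    let ?o = complex_of_real
    note ints = integrable_on_mult_test_fun[OF _ \<phi>'] integrable_on_mult_test_fun[OF _ \<phi>'']
    have w2: "continuous_on {0..1} (\<lambda>x. 2 * ?o x * w x)" "continuous_on {0..1} (\<lambda>x. ?o (x\<^sup>2) * w x)"
      by (intro continuous_intros w)+
    have "integral {0..1} (\<lambda>x. w x * ?o (2 * x * deriv \<phi> x + x\<^sup>2 * deriv (deriv \<phi>) x))
      = integral {0..1} (\<lambda>x. (2 * ?o x * w x) * ?o (deriv \<phi> x) + (?o (x\<^sup>2) * w x) * ?o (deriv (deriv \<phi>) x))"
      by (simp add: algebra_simps)
    also have "\<dots> = integral {0..1} (\<lambda>x. (2 * ?o x * w x) * ?o (deriv \<phi> x))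
        + integral {0..1} (\<lambda>x. (?o (x\<^sup>2) * w x) * ?o (deriv (deriv \<phi>) x))"
      by (rule integral_add) (intro ints w2)+
    finally have 1: "integral {0..1} (\<lambda>x. w x * ?o (2 * x * deriv \<phi> x + x\<^sup>2 * deriv (deriv \<phi>) x)) = \<dots>" .
    have 2: "integral {0..1} (\<lambda>x. h x * ?o (\<phi> x)) = - integral {0..1} (\<lambda>x. H x * ?o (deriv \<phi> x))"
      by (rule integration_by_parts_test_fun[OF dH ch \<phi>])
    have 3: "integral {0..1} (\<lambda>x. k x * ?o (deriv \<phi> x)) = - integral {0..1} (\<lambda>x. M x * ?o (deriv (deriv \<phi>) x))"
      by (rule integration_by_parts_test_fun[OF dM ck \<phi>'])
    have "integral {0..1} (\<lambda>x. k x * ?o (deriv \<phi> x)) = integral {0..1} (\<lambda>x. s * (w x * ?o (deriv \<phi> x))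
        - (2 * ?o x * w x) * ?o (deriv \<phi> x) - H x * ?o (deriv \<phi> x))"
      by (simp add: k_def algebra_simps)
    also have "\<dots> = integral {0..1} (\<lambda>x. s * (w x * ?o (deriv \<phi> x)) - (2 * ?o x * w x) * ?o (deriv \<phi> x))
        - integral {0..1} (\<lambda>x. H x * ?o (deriv \<phi> x))"
      by (rule integral_diff) (intro integrable_diff integrable_on_mult_right ints w2 w cH)+
    also have "integral {0..1} (\<lambda>x. s * (w x * ?o (deriv \<phi> x)) - (2 * ?o x * w x) * ?o (deriv \<phi> x))
       = integral {0..1} (\<lambda>x. s * (w x * ?o (deriv \<phi> x))) - integral {0..1} (\<lambda>x. (2 * ?o x * w x) * ?o (deriv \<phi> x))"
      by (rule integral_diff) (intro integrable_diff integrable_on_mult_right ints w2 w)+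
    finally have 4: "integral {0..1} (\<lambda>x. k x * ?o (deriv \<phi> x)) = s * integral {0..1} (\<lambda>x. w x * ?o (deriv \<phi> x))
      - integral {0..1} (\<lambda>x. (2 * ?o x * w x) * ?o (deriv \<phi> x)) - integral {0..1} (\<lambda>x. H x * ?o (deriv \<phi> x))"
      by simp
    have "integral {0..1} (\<lambda>x. r x * ?o (deriv (deriv \<phi>) x)) = integral {0..1}
        (\<lambda>x. (?o (x\<^sup>2) * w x) * ?o (deriv (deriv \<phi>) x) + M x * ?o (deriv (deriv \<phi>) x))"
      by (simp add: r_def algebra_simps)
    also have "\<dots> = integral {0..1} (\<lambda>x. (?o (x\<^sup>2) * w x) * ?o (deriv (deriv \<phi>) x))
        + integral {0..1} (\<lambda>x. M x * ?o (deriv (deriv \<phi>) x))"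
      by (rule integral_add) (intro ints w2 cM)+
    finally show "integral {0..1} (\<lambda>x. r x * ?o (deriv (deriv \<phi>) x)) = 0"
      using weak_solution_identity[OF ae eq \<phi>] 1 2 3 4 unfolding h_def by (simp add: algebra_simps)
  qed
  then obtain C D where CD: "\<And>x. x \<in> {0..1} \<Longrightarrow> r x = C + D * complex_of_real x" by blast
  have "((\<lambda>x. complex_of_real (x\<^sup>2) * w x) has_vector_derivative D - k x) (at x within {0..1})"
    if x: "x \<in> {0..1}" for x
  proof (rule has_vector_derivative_transform[OF x])
    show "complex_of_real (y\<^sup>2) * w y = (C + D * complex_of_real y) - M y" if "y \<in> {0..1}" for y
      using CD[OF that] unfolding r_def by (simp add: algebra_simps)
    have "(complex_of_real has_vector_derivative 1) (at x within {0..1})"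
      using has_vector_derivative_of_real[OF DERIV_ident, of "at x within {0..1}"] by simp
    then show "((\<lambda>y. (C + D * complex_of_real y) - M y) has_vector_derivative D - k x) (at x within {0..1})"
      using has_vector_derivative_diff[OF has_vector_derivative_add[OF has_vector_derivative_const
            has_vector_derivative_mult_right] dM[OF x], of complex_of_real 1 C D] by simp
  qed
  then show ?thesis unfolding k_def H_def h_def by (intro exI[of _ D]) (simp add: algebra_simps)
qed

text \<open>Below \<delta> both \<open>w\<close> and its derivative are 0, which forces the
  numerator \<open>R - s w\<close> to vanish there. This second conclusion is what later permits
  repeated division by powers of \<open>x\<close>.\<close>

lemma weak_solution_first_order:
  fixes W f u w :: "real \<Rightarrow> complex"
  assumes W: "continuous_on {0..1} W" and f: "continuous_on {0..1} f" and w: "continuous_on {0..1} w"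
    and ae: "AE x in lebesgue. x \<in> {0<..<1} \<longrightarrow> w x = u x"
    and eq: "L_op_eq s W u f" and \<delta>: "0 < \<delta>" and w0: "\<And>x. x \<in> {0..1} \<Longrightarrow> x < \<delta> \<Longrightarrow> w x = 0"
  obtains R where
    "\<And>x. x \<in> {0..1} \<Longrightarrow> (R has_vector_derivative f x + W x * w x) (at x within {0..1})"
    "\<And>x. x \<in> {0..1} \<Longrightarrow> x < \<delta> \<Longrightarrow> R x - s * w x = 0"
    "\<And>x. x \<in> {0..1} \<Longrightarrow> (w has_vector_derivative (R x - s * w x) / of_real x ^ 2) (at x within {0..1})"
proof -
  obtain D where D: "\<And>x. x \<in> {0..1} \<Longrightarrow> ((\<lambda>x. complex_of_real (x\<^sup>2) * w x) has_vector_derivative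
    D + integral {0..x} (\<lambda>t. f t + W t * w t) - s * w x + 2 * of_real x * w x) (at x within {0..1})"
    using weak_solution_differentiable[OF W f w ae eq] by blast
  define R where "R x = D + integral {0..x} (\<lambda>t. f t + W t * w t)" for x
  have "continuous_on {0..1} (\<lambda>t. f t + W t * w t)" by (intro continuous_intros W f w)
  from integral_has_vector_derivative[OF this]
  have dR: "(R has_vector_derivative f x + W x * w x) (at x within {0..1})" if "x \<in> {0..1}" for x
    unfolding R_def
    using has_vector_derivative_add[OF has_vector_derivative_const, of _ _ "at x within {0..1}" D] that by fastforce
  then have cR: "continuous_on {0..1} R"
    using has_vector_derivative_continuous continuous_on_eq_continuous_within by blast
  have pos: "(w has_vector_derivative (R x - s * w x) / of_real x ^ 2) (at x within {0..1})"
    if x: "x \<in> {0..1}" "x > 0" for x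
  proof -
    let ?P = "\<lambda>x. complex_of_real (x\<^sup>2) * w x"
    have "((\<lambda>y. 1 / y\<^sup>2) has_real_derivative - 2 / x ^ 3) (at x within {0..1})"
      using x by (auto intro!: derivative_eq_intros simp: field_simps power2_eq_square power3_eq_cube)
    then have "((\<lambda>y. complex_of_real (1 / y\<^sup>2)) has_vector_derivative complex_of_real (- 2 / x ^ 3)) (at x within {0..1})"
      by (rule has_vector_derivative_of_real)
    from has_vector_derivative_mult[OF D[OF x(1)] this]
    have "((\<lambda>y. ?P y * complex_of_real (1 / y\<^sup>2)) has_vector_derivative
        ?P x * complex_of_real (- 2 / x ^ 3) + (R x - s * w x + 2 * of_real x * w x) * complex_of_real (1 / x\<^sup>2)) (at x within {0..1})"
      by (simp add: R_def)
    moreover have "?P x * complex_of_real (- 2 / x ^ 3) + (R x - s * w x + 2 * of_real x * w x) * complex_of_real (1 / x\<^sup>2)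
      = (R x - s * w x) / of_real x ^ 2"
      using x by (simp add: field_simps power2_eq_square power3_eq_cube)
    ultimately have "((\<lambda>y. ?P y * complex_of_real (1 / y\<^sup>2)) has_vector_derivative
        (R x - s * w x) / of_real x ^ 2) (at x within {0..1})" by simp
    \<comment> \<open>The radius \<open>x\<close> keeps the neighbourhood away from 0, where
      cancelling \<open>y\<^sup>2\<close> would fail.\<close>
    then show ?thesis
      by (rule has_vector_derivative_transform_within[where d = x])
        (use x in \<open>auto simp: dist_real_def\<close>)
  qed
  have near0: "(w has_vector_derivative 0) (at x within {0..1})" if "x \<in> {0..1}" "x < \<delta>" for x
    by (rule has_vector_derivative_transform_within[where d = "\<delta> - x" and f = "\<lambda>x. 0"])
      (use that w0 in \<open>auto simp: dist_real_def\<close>)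
  have "R x - s * w x = 0" if "x \<in> {0..1}" "0 < x" "x < \<delta>" for x
  proof -
    have "(R x - s * w x) / of_real x ^ 2 = 0"
      using vector_derivative_unique_within[OF _ pos[OF that(1,2)] near0[OF that(1,3)]] that
      by (metis atLeastAtMost_iff islimpt_Icc trivial_limit_within zero_less_one)
    then show ?thesis using that by simp
  qed
  define m where "m = min \<delta> 1"
  have m: "m > 0" "closure {0<..<m} = {0..m}" using \<delta> by (auto simp: m_def)
  \<comment> \<open>The quotient formula is available for \<open>x > 0\<close> only, so the value at
    0 is obtained from continuity.\<close>
  have "R 0 - s * w 0 = 0"
  proof (rule continuous_constant_on_closure[where S = "{0<..<m}" and f = "\<lambda>x. R x - s * w x"])
    show "continuous_on (closure {0<..<m}) (\<lambda>x. R x - s * w x)" unfolding m(2)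
      by (rule continuous_on_subset[of "{0..1}"]) (auto intro!: continuous_intros cR w simp: m_def)
    show "R x - s * w x = 0" if "x \<in> {0<..<m}" for x
      using \<open>\<And>x. \<lbrakk>x \<in> {0..1}; 0 < x; x < \<delta>\<rbrakk> \<Longrightarrow> R x - s * w x = 0\<close>[of x] that by (auto simp: m_def)
  qed (use m in auto)
  have Rzero: "R x - s * w x = 0" if "x \<in> {0..1}" "x < \<delta>" for x
    using \<open>\<And>x. \<lbrakk>x \<in> {0..1}; 0 < x; x < \<delta>\<rbrakk> \<Longrightarrow> R x - s * w x = 0\<close>[of x] \<open>R 0 - s * w 0 = 0\<close> that
    by (cases "x = 0") auto
  \<comment> \<open>At \<open>x = 0\<close> the quotient has denominator 0 and therefore denotes 0,
    which agrees with the derivative of \<open>w\<close> there.\<close>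
  have "(w has_vector_derivative (R x - s * w x) / of_real x ^ 2) (at x within {0..1})" if "x \<in> {0..1}" for x
    using pos[OF that] near0[of 0] \<delta> that by (cases "x = 0") auto
  then show ?thesis using that[of R] dR Rzero by blast
qed

section \<open>Smoothness up to the boundary\<close>

lemma trivial_limit_unit_interval: "x \<in> {0..1} \<Longrightarrow> at x within {0..1::real} \<noteq> bot"
  by (simp add: trivial_limit_within islimpt_Icc)

lemma has_vector_derivative_unique_unit_interval:
  assumes "x \<in> {0..1::real}" "(f has_vector_derivative a) (at x within {0..1})"
    "(f has_vector_derivative b) (at x within {0..1})"
  shows "a = b"
  using vector_derivative_unique_within[OF trivial_limit_unit_interval] assms by blast

lemma nderiv_Suc_eq:
  assumes "x \<in> {0..1}" "(nderiv n u has_vector_derivative d) (at x within {0..1})"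
  shows "nderiv (Suc n) u x = d"
  using vector_derivative_within[OF trivial_limit_unit_interval assms(2)] assms(1) by simp

lemma smooth_I_has_vector_derivative:
  assumes "smooth_I u" "x \<in> {0..1}"
  shows "(nderiv n u has_vector_derivative nderiv (Suc n) u x) (at x within {0..1})"
  using assms unfolding smooth_I_def by blast

lemma continuous_on_nderiv: "smooth_I u \<Longrightarrow> continuous_on {0..1} (nderiv n u)"
  using smooth_I_has_vector_derivative has_vector_derivative_continuous
    continuous_on_eq_continuous_within by blast

lemma smooth_I_imp_times_differentiable_on:
  assumes "smooth_I u" shows "times_differentiable_on m (nderiv n u) {0..1}"
proof (induction m arbitrary: n)
  case (Suc m)
  show ?case
    by (rule times_differentiable_on_SucI[where f' = "nderiv (Suc n) u"])
      (use Suc smooth_I_has_vector_derivative[OF assms] in blast)+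
qed simp

text \<open>Derivatives within the unit interval are unique even at the endpoints, so any chain of
  witnesses must coincide with \<open>nderiv\<close>.\<close>

lemma smooth_I_iff: "smooth_I u \<longleftrightarrow> (\<forall>n. times_differentiable_on n u {0..1})"
proof
  assume "smooth_I u"
  then show "\<forall>n. times_differentiable_on n u {0..1}"
    using smooth_I_imp_times_differentiable_on[of u _ 0] by simp
next
  assume *: "\<forall>n. times_differentiable_on n u {0..1}"
  have td: "times_differentiable_on m (nderiv n u) {0..1}" for n m
  proof (induction n arbitrary: m)
    case (Suc n)
    obtain g where g: "\<And>x. x \<in> {0..1} \<Longrightarrow> (nderiv n u has_vector_derivative g x) (at x within {0..1})"
      "times_differentiable_on m g {0..1}" using times_differentiable_on_SucE[OF Suc[of "Suc m"]] by blast
    show ?case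
      by (rule times_differentiable_on_cong[OF _ g(2)]) (use nderiv_Suc_eq g(1) in metis)
  qed (use * in simp)
  show "smooth_I u" unfolding smooth_I_def
  proof (intro allI ballI)
    fix n and x :: real assume x: "x \<in> {0..1}"
    obtain g where "\<And>x. x \<in> {0..1} \<Longrightarrow> (nderiv n u has_vector_derivative g x) (at x within {0..1})"
      using times_differentiable_on_SucE[OF td[of "Suc 0" n]] by blast
    then show "(nderiv n u has_vector_derivative nderiv (Suc n) u x) (at x within {0..1})"
      using nderiv_Suc_eq x by metis
  qed
qed

lemma has_vector_derivative_zero_near_0:
  assumes "x \<in> {0..1::real}" "x < \<delta>" "\<And>y. y \<in> {0..1} \<Longrightarrow> y < \<delta> \<Longrightarrow> g y = 0"
  shows "(g has_vector_derivative 0) (at x within {0..1})"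
  by (rule has_vector_derivative_transform_within[where d = "\<delta> - x" and f = "\<lambda>x. 0"])
    (use assms in \<open>auto simp: dist_real_def\<close>)

text \<open>The exponent is generalised because the quotient rule raises it: the derivative is
  \<open>R' / x^k - k R / x^(k+1)\<close>. The induction closes since \<open>R'\<close> inherits the
  vanishing below \<delta>.\<close>

lemma times_differentiable_on_divide_power:
  fixes R :: "real \<Rightarrow> complex"
  assumes "times_differentiable_on n R {0..1}" "0 < \<delta>" "\<And>x. x \<in> {0..1} \<Longrightarrow> x < \<delta> \<Longrightarrow> R x = 0"
  shows "times_differentiable_on n (\<lambda>x. R x / of_real x ^ k) {0..1}"
  using assms(1,3)
proof (induction n arbitrary: R k)
  case (Suc n)
  obtain R' where R': "\<And>x. x \<in> {0..1} \<Longrightarrow> (R has_vector_derivative R' x) (at x within {0..1})"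
    "times_differentiable_on n R' {0..1}" using times_differentiable_on_SucE[OF Suc.prems(1)] by blast
  have zero: "R' x = 0" if "x \<in> {0..1}" "x < \<delta>" for x
    by (rule has_vector_derivative_unique_unit_interval[OF that(1) R'(1)[OF that(1)]
          has_vector_derivative_zero_near_0[OF that]]) (rule Suc.prems(2))
  let ?g = "\<lambda>x. R' x / of_real x ^ k + (- of_nat k) * (R x / of_real x ^ Suc k)"
  show ?case
  proof (rule times_differentiable_on_SucI[where f' = ?g])
    show "times_differentiable_on n ?g {0..1}"
      by (intro times_differentiable_on_add times_differentiable_on_cmult Suc.IH R'(2) zero
          Suc.prems(2) times_differentiable_on_SucD[OF Suc.prems(1)])
    fix x :: real assume x: "x \<in> {0..1}"
    show "((\<lambda>x. R x / of_real x ^ k) has_vector_derivative ?g x) (at x within {0..1})"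
    proof (cases "x < \<delta>")
      case True
      have "((\<lambda>x. R x / of_real x ^ k) has_vector_derivative 0) (at x within {0..1})"
        by (rule has_vector_derivative_zero_near_0[OF x True]) (simp add: Suc.prems(2))
      then show ?thesis using zero[OF x True] Suc.prems(2)[OF x True] by simp
    next
      case False
      then have x0: "x > 0" using \<open>0 < \<delta>\<close> by simp
      have "((\<lambda>y. inverse (y ^ k)) has_real_derivative - real k * inverse (x ^ Suc k)) (at x within {0..1})"
        by (rule DERIV_cong[OF DERIV_inverse_fun[OF DERIV_pow]], use x0 in simp)
          (use x0 in \<open>cases k; simp add: field_simps\<close>)
      then have "((\<lambda>y. complex_of_real (inverse (y ^ k))) has_vector_derivative
          complex_of_real (- real k * inverse (x ^ Suc k))) (at x within {0..1})"
        by (rule has_vector_derivative_of_real)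
      from has_vector_derivative_mult[OF R'(1)[OF x] this]
      show ?thesis by (simp add: divide_inverse algebra_simps)
    qed
  qed
qed simp

text \<open>Each round gains one derivative: if \<open>w\<close> is \<open>n\<close> times
  differentiable, then so is \<open>R' = f + W w\<close>, hence also \<open>R - s w\<close> and the
  quotient by \<open>x\<^sup>2\<close>, which is \<open>w'\<close>.\<close>

lemma weak_solution_smooth:
  fixes W f u w :: "real \<Rightarrow> complex"
  assumes W: "smooth_I W" and f: "smooth_I f" and w: "continuous_on {0..1} w"
    and ae: "AE x in lebesgue. x \<in> {0<..<1} \<longrightarrow> w x = u x"
    and eq: "L_op_eq s W u f" and \<delta>: "0 < \<delta>" and w0: "\<And>x. x \<in> {0..1} \<Longrightarrow> x < \<delta> \<Longrightarrow> w x = 0"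
  shows "smooth_I w"
    and "\<And>x. x \<in> {0..1} \<Longrightarrow> of_real x ^ 2 * nderiv 2 w x + (2 * of_real x + s) * nderiv 1 w x = f x + W x * w x"
proof -
  obtain R where R: "\<And>x. x \<in> {0..1} \<Longrightarrow> (R has_vector_derivative f x + W x * w x) (at x within {0..1})"
    "\<And>x. x \<in> {0..1} \<Longrightarrow> x < \<delta> \<Longrightarrow> R x - s * w x = 0"
    "\<And>x. x \<in> {0..1} \<Longrightarrow> (w has_vector_derivative (R x - s * w x) / of_real x ^ 2) (at x within {0..1})"
    using weak_solution_first_order[OF continuous_on_nderiv[OF W, of 0, simplified]
        continuous_on_nderiv[OF f, of 0, simplified] w ae eq \<delta> w0] by blast
  have "times_differentiable_on n w {0..1}" for n
  proof (induction n)
    case (Suc n)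
    have fW: "times_differentiable_on n f {0..1}" "times_differentiable_on n W {0..1}"
      using f W unfolding smooth_I_iff by blast+
    have "times_differentiable_on (Suc n) R {0..1}"
      by (rule times_differentiable_on_SucI[OF R(1)], assumption)
        (intro times_differentiable_on_add times_differentiable_on_mult fW Suc)
    then have "times_differentiable_on n (\<lambda>x. R x - s * w x) {0..1}"
      by (intro times_differentiable_on_diff times_differentiable_on_cmult Suc)
        (rule times_differentiable_on_SucD)
    then have "times_differentiable_on n (\<lambda>x. (R x - s * w x) / of_real x ^ 2) {0..1}"
      by (rule times_differentiable_on_divide_power[OF _ \<delta>]) (rule R(2))
    then show ?case by (intro times_differentiable_on_SucI[OF R(3)])
  qed simp
  then show smooth: "smooth_I w" unfolding smooth_I_iff by blast
  fix x :: real assume x: "x \<in> {0..1}"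
  let ?w1 = "nderiv (Suc 0) w" and ?w2 = "nderiv (Suc (Suc 0)) w"
  have d0: "(w has_vector_derivative ?w1 y) (at y within {0..1})"
    and d1: "(?w1 has_vector_derivative ?w2 y) (at y within {0..1})" if "y \<in> {0..1}" for y
    using smooth_I_has_vector_derivative[OF smooth that, of 0]
      smooth_I_has_vector_derivative[OF smooth that, of "Suc 0"] by (simp_all only: nderiv.simps(1))
  \<comment> \<open>Undoing the division gives an identity that holds at 0 as well, so it can be
    differentiated on the whole interval to recover the second-order equation.\<close>
  have "R y - s * w y = of_real y ^ 2 * ?w1 y" if y: "y \<in> {0..1}" for y
    using has_vector_derivative_unique_unit_interval[OF y d0[OF y] R(3)[OF y]] R(2)[OF y] \<delta> y
    by (cases "y = 0") (auto simp: field_simps)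
  moreover have "((\<lambda>y. of_real y ^ 2 * ?w1 y) has_vector_derivative
      of_real x ^ 2 * ?w2 x + 2 * of_real x * ?w1 x) (at x within {0..1})"
  proof -
    have "((\<lambda>y. y ^ 2) has_real_derivative 2 * x) (at x within {0..1})"
      by (auto intro!: derivative_eq_intros)
    from has_vector_derivative_mult[OF has_vector_derivative_of_real[OF this] d1[OF x]]
    show ?thesis by simp
  qed
  ultimately have "((\<lambda>y. R y - s * w y) has_vector_derivative
      of_real x ^ 2 * ?w2 x + 2 * of_real x * ?w1 x) (at x within {0..1})"
    using has_vector_derivative_transform[OF x, of "\<lambda>y. R y - s * w y"] by simp
  from has_vector_derivative_unique_unit_interval[OF x this
      has_vector_derivative_diff[OF R(1)[OF x] has_vector_derivative_mult_right[OF d0[OF x], of s]]]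
  show "of_real x ^ 2 * nderiv 2 w x + (2 * of_real x + s) * nderiv 1 w x = f x + W x * w x"
    by (simp add: algebra_simps numeral_2_eq_2 del: nderiv.simps)
qed

text \<open>The inductive step of the Leibniz rule, by Pascal's identity. \<open>A\<close> and
  \<open>B\<close> stand for the sequences of successive derivatives of the two factors.\<close>

lemma Leibniz_sum_has_vector_derivative:
  fixes A B :: "nat \<Rightarrow> real \<Rightarrow> complex"
  assumes "\<And>n. (A n has_vector_derivative A (Suc n) x) (at x within S)"
    and "\<And>n. (B n has_vector_derivative B (Suc n) x) (at x within S)"
  shows "((\<lambda>x. \<Sum>k\<le>n. of_nat (n choose k) * (A k x * B (n - k) x)) has_vector_derivative
    (\<Sum>k\<le>Suc n. of_nat (Suc n choose k) * (A k x * B (Suc n - k) x))) (at x within S)"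
proof -
  let ?c = "\<lambda>n k. of_nat (n choose k) :: complex"
  have "((\<lambda>x. \<Sum>k\<le>n. ?c n k * (A k x * B (n - k) x)) has_vector_derivative
    (\<Sum>k\<le>n. ?c n k * (A k x * B (Suc (n - k)) x + A (Suc k) x * B (n - k) x))) (at x within S)"
    by (intro has_vector_derivative_sum has_vector_derivative_mult_right has_vector_derivative_mult assms)
  moreover have "(\<Sum>k\<le>n. ?c n k * (A k x * B (Suc (n - k)) x + A (Suc k) x * B (n - k) x))
     = (\<Sum>k\<le>Suc n. ?c (Suc n) k * (A k x * B (Suc n - k) x))"
  proof -
    have "(\<Sum>k\<le>Suc n. ?c (Suc n) k * (A k x * B (Suc n - k) x)) =
        A 0 x * B (Suc n) x + (\<Sum>k\<le>n. ?c (Suc n) (Suc k) * (A (Suc k) x * B (n - k) x))"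
      by (subst sum.atMost_Suc_shift) simp
    also have "(\<Sum>k\<le>n. ?c (Suc n) (Suc k) * (A (Suc k) x * B (n - k) x)) =
        (\<Sum>k\<le>n. ?c n k * (A (Suc k) x * B (n - k) x)) + (\<Sum>k\<le>n. ?c n (Suc k) * (A (Suc k) x * B (n - k) x))"
      by (simp add: sum.distrib[symmetric] algebra_simps)
    also have "A 0 x * B (Suc n) x + (\<dots>) = (\<Sum>k\<le>n. ?c n k * (A (Suc k) x * B (n - k) x)) +
        (\<Sum>k\<le>Suc n. ?c n k * (A k x * B (Suc n - k) x))"
      by (subst sum.atMost_Suc_shift) simp
    also have "(\<Sum>k\<le>Suc n. ?c n k * (A k x * B (Suc n - k) x)) = (\<Sum>k\<le>n. ?c n k * (A k x * B (Suc (n - k)) x))"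
      by (simp add: Suc_diff_le)
    finally show ?thesis by (simp add: sum.distrib algebra_simps)
  qed
  ultimately show ?thesis by simp
qed

text \<open>The equation is differentiated \<open>n\<close> times. Since \<open>x\<^sup>2\<close>
  has only two nonzero derivatives, \<open>x\<^sup>2 w''\<close> and \<open>2 x w'\<close>
  contribute \<open>2 n + 2\<close> to the coefficient of order \<open>n + 1\<close> (apart from
  \<open>s\<close>) and \<open>n (n - 1) + 2 n\<close> to that of order \<open>n\<close>.\<close>

lemma nderiv_recurrence:
  assumes W: "smooth_I W" and f: "smooth_I f" and w: "smooth_I w"
    and ode: "\<And>x. x \<in> {0..1} \<Longrightarrow>
      of_real x ^ 2 * nderiv 2 w x + (2 * of_real x + s) * nderiv 1 w x = f x + W x * w x"
    and x: "x \<in> {0..1}"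
  shows "of_real x ^ 2 * nderiv (n + 2) w x + (2 * (of_nat n + 1) * of_real x + s) * nderiv (n + 1) w x
      + of_nat n * (of_nat n + 1) * nderiv n w x =
    nderiv n f x + (\<Sum>k\<le>n. of_nat (n choose k) * (nderiv k W x * nderiv (n - k) w x))"
  using x
proof (induction n arbitrary: x)
  case 0
  then show ?case using ode[OF 0] by (simp add: numeral_2_eq_2 del: nderiv.simps(2))
next
  case (Suc n)
  let ?o = "of_real :: real \<Rightarrow> complex"
  let ?L = "\<lambda>x. ?o x ^ 2 * nderiv (n + 2) w x + (2 * (of_nat n + 1) * ?o x + s) * nderiv (n + 1) w x
      + of_nat n * (of_nat n + 1) * nderiv n w x"
  let ?F = "\<lambda>x. nderiv n f x + (\<Sum>k\<le>n. of_nat (n choose k) * (nderiv k W x * nderiv (n - k) w x))"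
  note dw = smooth_I_has_vector_derivative[OF w Suc.prems]
  have "(?F has_vector_derivative nderiv (Suc n) f x +
      (\<Sum>k\<le>Suc n. of_nat (Suc n choose k) * (nderiv k W x * nderiv (Suc n - k) w x))) (at x within {0..1})"
    by (intro has_vector_derivative_add Leibniz_sum_has_vector_derivative
        smooth_I_has_vector_derivative W f w Suc.prems)
  then have 1: "(?L has_vector_derivative nderiv (Suc n) f x +
      (\<Sum>k\<le>Suc n. of_nat (Suc n choose k) * (nderiv k W x * nderiv (Suc n - k) w x))) (at x within {0..1})"
    by (rule has_vector_derivative_transform[OF Suc.prems, rotated]) (rule Suc.IH)
  have o1: "(?o has_vector_derivative 1) (at x within {0..1})"
    using has_vector_derivative_of_real[OF DERIV_ident, of "at x within {0..1}"] by simp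
  have "((\<lambda>y. y ^ 2) has_real_derivative 2 * x) (at x within {0..1})"
    by (auto intro!: derivative_eq_intros)
  from has_vector_derivative_of_real[OF this]
  have o2: "((\<lambda>y. ?o y ^ 2) has_vector_derivative 2 * ?o x) (at x within {0..1})" by simp
  have "((\<lambda>y. 2 * (of_nat n + 1) * ?o y + s) has_vector_derivative 2 * (of_nat n + 1) * 1 + 0) (at x within {0..1})"
    by (intro has_vector_derivative_add has_vector_derivative_mult_right o1 has_vector_derivative_const)
  from has_vector_derivative_add[OF has_vector_derivative_add[OF has_vector_derivative_mult[OF o2 dw[of "n + 2"]]
        has_vector_derivative_mult[OF this dw[of "n + 1"]]] has_vector_derivative_mult_right[OF dw[of n]],
      of "of_nat n * (of_nat n + 1)"]
  have 2: "(?L has_vector_derivative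
      (?o x ^ 2 * nderiv (Suc (n + 2)) w x + 2 * ?o x * nderiv (n + 2) w x
      + ((2 * (of_nat n + 1) * ?o x + s) * nderiv (Suc (n + 1)) w x + (2 * (of_nat n + 1) * 1 + 0) * nderiv (n + 1) w x)
      + of_nat n * (of_nat n + 1) * nderiv (Suc n) w x)) (at x within {0..1})" .
  show ?case
    using has_vector_derivative_unique_unit_interval[OF Suc.prems 2 1]
    by (simp add: algebra_simps del: nderiv.simps sum.atMost_Suc)
qed

section \<open>A recursive inequality\<close>

text \<open>From some index \<open>N\<close> on, the factor stays below a fixed
  \<open>q < 1\<close>; before that, each step costs at most a factor \<open>A\<close>. Neither
  depends on the sequences, so one constant serves all of them.\<close>

lemma eventually_contracting_sum_bound:
  fixes \<rho> K :: real
  assumes "0 \<le> \<rho>" "\<rho> < 1" "0 \<le> K"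
  obtains C where "0 \<le> C" "\<And>(a :: nat \<Rightarrow> real) b B m. \<lbrakk>\<And>n. 0 \<le> a n; \<And>n. 0 \<le> b n;
    \<And>n. a (Suc n) \<le> (\<rho> + K / (real n + 2)\<^sup>2) * a n + b n; \<And>m. a 0 + sum b {..<m} \<le> B\<rbrakk>
    \<Longrightarrow> sum a {..<m} \<le> C * B"
proof -
  define q where "q = (1 + \<rho>) / 2"
  have q: "\<rho> < q" "q < 1" using assms by (auto simp: q_def)
  obtain N :: nat where N: "K / (q - \<rho>) < real N" using reals_Archimedean2 by blast
  have small: "\<rho> + K / (real n + 2)\<^sup>2 \<le> q" if "n \<ge> N" for n
  proof -
    have "K < (q - \<rho>) * real N" using N q by (simp add: field_simps)
    also have "\<dots> \<le> (q - \<rho>) * (real n + 2)\<^sup>2"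
    proof (rule mult_left_mono)
      have "real N \<le> real n + 2" using that by simp
      also have "\<dots> \<le> (real n + 2)\<^sup>2" by (simp add: power2_eq_square)
      finally show "real N \<le> (real n + 2)\<^sup>2" .
    qed (use q in simp)
    finally have "K / (real n + 2)\<^sup>2 \<le> q - \<rho>" by (simp add: pos_divide_le_eq)
    then show ?thesis by simp
  qed
  define A where "A = 1 + \<rho> + K"
  have A: "A \<ge> 1" using assms by (simp add: A_def)
  have bounded: "\<rho> + K / (real n + 2)\<^sup>2 \<le> A" for n
  proof -
    have "1 \<le> (real n + 2)\<^sup>2" by (simp add: power2_eq_square algebra_simps)
    then have "K / (real n + 2)\<^sup>2 \<le> K" using assms by (simp add: divide_le_eq mult_le_cancel_left1)
    then show ?thesis by (simp add: A_def)
  qed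
  \<comment> \<open>The first summand accounts for \<open>N\<close> early terms of size at most
    \<open>A ^ N * B\<close>. The second is the geometric tail, started from a term of that size and
    fed by \<open>b\<close>.\<close>
  define C where "C = real N * A ^ N + (A ^ N + 1) / (1 - q)"
  show ?thesis
  proof (rule that[of C])
    show "0 \<le> C" using A q by (simp add: C_def)
    fix a b :: "nat \<Rightarrow> real" and B m
    assume a: "\<And>n. 0 \<le> a n" and b: "\<And>n. 0 \<le> b n"
      and step: "\<And>n. a (Suc n) \<le> (\<rho> + K / (real n + 2)\<^sup>2) * a n + b n"
      and B: "\<And>m. a 0 + sum b {..<m} \<le> B"
    have B0: "0 \<le> B" using B[of 0] a[of 0] by simp
    have growth: "a n \<le> A ^ n * (a 0 + sum b {..<n})" for n
    proof (induction n)
      case (Suc n)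
      have "a (Suc n) \<le> A * a n + b n"
        using step[of n] mult_right_mono[OF bounded[of n] a[of n]] by simp
      also have "\<dots> \<le> A * (A ^ n * (a 0 + sum b {..<n})) + A ^ Suc n * b n"
        using Suc A b[of n] one_le_power[OF A, of "Suc n"]
        by (intro add_mono mult_left_mono) (auto simp: mult_le_cancel_right1 simp del: power_Suc)
      finally show ?case by (simp add: algebra_simps)
    qed simp
    have early: "a n \<le> A ^ N * B" if "n \<le> N" for n
    proof -
      have "a n \<le> A ^ n * B"
        by (rule order_trans[OF growth mult_left_mono[OF B]]) (use A in simp)
      also have "\<dots> \<le> A ^ N * B" using that A B0 by (intro mult_right_mono power_increasing) auto
      finally show ?thesis .
    qed
    \<comment> \<open>Keeping the current term \<open>a m\<close> on the left makes the induction
      close: \<open>(1 - q) * a m + a (Suc m)\<close> is at most \<open>a m + b m\<close>.\<close>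
    have late: "(1 - q) * sum a {N..<m} + a m \<le> a N + sum b {N..<m}" if "m \<ge> N" for m
      using that
    proof (induction m rule: dec_induct)
      case (step m)
      have "a (Suc m) \<le> q * a m + b m"
        using \<open>\<And>n. a (Suc n) \<le> (\<rho> + K / (real n + 2)\<^sup>2) * a n + b n\<close>[of m]
          mult_right_mono[OF small[OF step(1)] a[of m]] by simp
      then show ?case using step by (simp add: algebra_simps)
    qed simp
    have "sum a {..<m} \<le> sum a {..<N} + sum a {N..<max N m}"
    proof -
      have "sum a {..<m} \<le> sum a {..<max N m}" using a by (intro sum_mono2) auto
      also have "\<dots> = sum a {..<N} + sum a {N..<max N m}"
        by (subst sum.union_disjoint[symmetric]) (auto intro: sum.cong)
      finally show ?thesis .
    qed
    also have "sum a {..<N} \<le> real N * (A ^ N * B)"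
      using sum_bounded_above[of "{..<N}" a "A ^ N * B"] early by simp
    also have "sum a {N..<max N m} \<le> (A ^ N + 1) * B / (1 - q)"
    proof -
      have "sum b {N..<max N m} \<le> sum b {..<max N m}" using b by (intro sum_mono2) auto
      also have "\<dots> \<le> B" using B[of "max N m"] a[of 0] by simp
      finally have "(1 - q) * sum a {N..<max N m} \<le> A ^ N * B + B"
        using late[of "max N m"] early[of N] a[of "max N m"] by simp
      then show ?thesis using q by (simp add: pos_le_divide_eq algebra_simps)
    qed
    finally show "sum a {..<m} \<le> C * B" by (simp add: C_def algebra_simps add_divide_distrib)
  qed
qed

text \<open>The convolution \<open>a\<close> satisfies
  \<open>a (Suc n) = \<rho> * a n + Y (n + 2)\<close>, so the inequality for \<open>Y\<close> turns
  into the one-step recursion of the preceding lemma. The resulting bound on the sum of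
  \<open>a\<close> is then put back into the original inequality, which yields the factor
  \<open>n\<^sup>2\<close>.\<close>

lemma geometric_convolution_summable:
  fixes \<rho> K :: real
  assumes "0 \<le> \<rho>" "\<rho> < 1" "0 \<le> K"
  obtains C where "0 \<le> C" "\<And>(Y :: nat \<Rightarrow> real) \<Phi>. \<lbrakk>\<And>n. 0 \<le> Y n; \<And>n. 0 \<le> \<Phi> n; summable \<Phi>;
    \<And>n. (real n + 2)\<^sup>2 * Y (n + 2) \<le> K * (\<Phi> n + (\<Sum>j\<le>n + 1. \<rho> ^ (n + 1 - j) * Y j))\<rbrakk>
    \<Longrightarrow> summable (\<lambda>n. (real n)\<^sup>2 * Y n) \<and> (\<Sum>n. (real n)\<^sup>2 * Y n) \<le> C * (suminf \<Phi> + Y 0 + Y 1)"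
proof -
  obtain C0 where C0: "0 \<le> C0" and C0b: "\<And>(a :: nat \<Rightarrow> real) b B m. \<lbrakk>\<And>n. 0 \<le> a n; \<And>n. 0 \<le> b n;
    \<And>n. a (Suc n) \<le> (\<rho> + K / (real n + 2)\<^sup>2) * a n + b n; \<And>m. a 0 + sum b {..<m} \<le> B\<rbrakk>
    \<Longrightarrow> sum a {..<m} \<le> C0 * B"
    using eventually_contracting_sum_bound[OF assms] by blast
  \<comment> \<open>The leading 1 covers \<open>Y 1\<close>. In the bracket, 1 accounts for the sum
    of \<Phi> and \<open>C0 * (1 + K)\<close> for the sum of \<open>a\<close>.\<close>
  define C where "C = 1 + K * (1 + C0 * (1 + K))"
  show ?thesis
  proof (rule that[of C])
    show "0 \<le> C" using assms C0 by (simp add: C_def)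
    fix Y \<Phi> :: "nat \<Rightarrow> real"
    assume Y: "\<And>n. 0 \<le> Y n" and \<Phi>: "\<And>n. 0 \<le> \<Phi> n" "summable \<Phi>"
      and rec: "\<And>n. (real n + 2)\<^sup>2 * Y (n + 2) \<le> K * (\<Phi> n + (\<Sum>j\<le>n + 1. \<rho> ^ (n + 1 - j) * Y j))"
    define a where "a n = (\<Sum>j\<le>n + 1. \<rho> ^ (n + 1 - j) * Y j)" for n
    define b where "b n = K * \<Phi> n" for n
    define S where "S = suminf \<Phi> + Y 0 + Y 1"
    have a0: "0 \<le> a n" for n unfolding a_def using assms Y by (intro sum_nonneg) auto
    have sum\<Phi>: "sum \<Phi> {..<m} \<le> suminf \<Phi>" for m
      by (rule sum_le_suminf) (use \<Phi> in auto)
    then have suminf0: "0 \<le> suminf \<Phi>" by (metis sum.empty lessThan_0)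
    have sum_a: "sum a {..<m} \<le> C0 * ((1 + K) * S)" for m
    proof (rule C0b[of a b])
      show "0 \<le> b n" for n using assms \<Phi> by (simp add: b_def)
      fix n
      have "a (Suc n) = (\<Sum>j\<le>n + 1. \<rho> ^ (n + 2 - j) * Y j) + Y (n + 2)"
        unfolding a_def by simp
      also have "(\<Sum>j\<le>n + 1. \<rho> ^ (n + 2 - j) * Y j) = \<rho> * a n"
        unfolding a_def sum_distrib_left
      proof (rule sum.cong)
        fix j assume "j \<in> {..n + 1}"
        then have "n + 2 - j = Suc (n + 1 - j)" by auto
        then show "\<rho> ^ (n + 2 - j) * Y j = \<rho> * (\<rho> ^ (n + 1 - j) * Y j)" by simp
      qed simp
      also have "Y (n + 2) \<le> K / (real n + 2)\<^sup>2 * a n + b n"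
      proof -
        have "1 \<le> (real n + 2)\<^sup>2" by (simp add: power2_eq_square algebra_simps)
        then have "K * \<Phi> n \<le> K * \<Phi> n * (real n + 2)\<^sup>2" using assms \<Phi>(1)[of n]
          mult_left_mono[of 1 "(real n + 2)\<^sup>2" "K * \<Phi> n"] by simp
        then have "(real n + 2)\<^sup>2 * Y (n + 2) \<le> K * \<Phi> n * (real n + 2)\<^sup>2 + K * a n"
          using rec[of n] by (simp add: a_def distrib_left)
        then show ?thesis by (simp add: b_def field_simps)
      qed
      finally show "a (Suc n) \<le> (\<rho> + K / (real n + 2)\<^sup>2) * a n + b n" by (simp add: algebra_simps)
    next
      fix m
      have "a 0 \<le> Y 0 + Y 1" using assms Y[of 0] by (simp add: a_def mult_left_le_one_le)
      moreover have "sum b {..<m} \<le> K * suminf \<Phi>"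
        unfolding b_def sum_distrib_left[symmetric] using sum\<Phi> assms by (intro mult_left_mono) auto
      moreover have "0 \<le> K * Y 0" "0 \<le> K * Y 1" using assms Y by auto
      ultimately show "a 0 + sum b {..<m} \<le> (1 + K) * S" using suminf0 by (simp add: S_def algebra_simps)
    qed (rule a0)
    have S0: "0 \<le> S" using suminf0 Y[of 0] Y[of 1] by (simp add: S_def)
    have part: "(\<Sum>n<m. (real n)\<^sup>2 * Y n) \<le> C * S" for m
    proof -
      have "(\<Sum>n<m. (real n)\<^sup>2 * Y n) \<le> (\<Sum>n<m + 2. (real n)\<^sup>2 * Y n)"
        using Y by (intro sum_mono2) auto
      also have "\<dots> = Y 1 + (\<Sum>n<m. (real n + 2)\<^sup>2 * Y (n + 2))"
        by (simp add: sum.lessThan_Suc_shift numeral_2_eq_2 add_ac del: sum.lessThan_Suc)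
      also have "(\<Sum>n<m. (real n + 2)\<^sup>2 * Y (n + 2)) \<le> (\<Sum>n<m. K * (\<Phi> n + a n))"
        using rec by (intro sum_mono) (simp add: a_def)
      also have "\<dots> = K * (sum \<Phi> {..<m} + sum a {..<m})"
        by (simp only: sum_distrib_left[symmetric] sum.distrib)
      also have "\<dots> \<le> K * (S + C0 * ((1 + K) * S))"
        using sum\<Phi>[of m] sum_a[of m] assms Y[of 0] Y[of 1] by (intro mult_left_mono add_mono) (auto simp: S_def)
      also have "Y 1 \<le> S" using suminf0 Y[of 0] by (simp add: S_def)
      finally show ?thesis by (simp add: C_def algebra_simps)
    qed
    have sm: "summable (\<lambda>n. (real n)\<^sup>2 * Y n)"
      by (rule summableI_nonneg_bounded[where x = "C * S"]) (use Y part in auto)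
    then show "summable (\<lambda>n. (real n)\<^sup>2 * Y n) \<and> (\<Sum>n. (real n)\<^sup>2 * Y n) \<le> C * (suminf \<Phi> + Y 0 + Y 1)"
      using suminf_le_const[OF sm part] by (simp add: S_def)
  qed
qed

text \<open>Cauchy-Schwarz with each weight split into two square roots; one factor is then a
  partial geometric series.\<close>

lemma geometric_sum_square_le:
  fixes y :: "nat \<Rightarrow> real"
  assumes "0 \<le> \<rho>" "\<rho> < 1"
  shows "(\<Sum>j\<le>m. \<rho> ^ (m - j) * y j)\<^sup>2 \<le> 1 / (1 - \<rho>) * (\<Sum>j\<le>m. \<rho> ^ (m - j) * (y j)\<^sup>2)"
proof -
  let ?r = "\<lambda>j. sqrt (\<rho> ^ (m - j))"
  have "(\<Sum>j\<le>m. \<rho> ^ (m - j) * y j)\<^sup>2 = (\<Sum>j\<le>m. ?r j * (?r j * y j))\<^sup>2"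
    using assms by (simp flip: mult.assoc)
  also have "\<dots> \<le> (\<Sum>j\<le>m. (?r j)\<^sup>2) * (\<Sum>j\<le>m. (?r j * y j)\<^sup>2)"
    by (rule Cauchy_Schwarz_ineq_sum)
  also have "\<dots> = (\<Sum>j\<le>m. \<rho> ^ (m - j)) * (\<Sum>j\<le>m. \<rho> ^ (m - j) * (y j)\<^sup>2)"
    using assms by (simp add: power_mult_distrib)
  also have "\<dots> \<le> 1 / (1 - \<rho>) * (\<Sum>j\<le>m. \<rho> ^ (m - j) * (y j)\<^sup>2)"
  proof (rule mult_right_mono)
    have "(\<Sum>j\<le>m. \<rho> ^ (m - j)) = (\<Sum>j\<le>m. \<rho> ^ j)"
      by (rule sum.reindex_bij_witness[where i = "\<lambda>j. m - j" and j = "\<lambda>j. m - j"]) auto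
    also have "\<dots> \<le> (\<Sum>j. \<rho> ^ j)" using assms by (intro sum_le_suminf summable_geometric) auto
    also have "\<dots> = 1 / (1 - \<rho>)" using assms by (intro suminf_geometric) auto
    finally show "(\<Sum>j\<le>m. \<rho> ^ (m - j)) \<le> 1 / (1 - \<rho>)" .
  qed (use assms in \<open>auto intro!: sum_nonneg\<close>)
  finally show ?thesis .
qed

section \<open>Energy estimate for the first derivative\<close>

text \<open>With the integrating factor \<open>exp (- L x)\<close>, the function \<open>P\<close> is
  nonincreasing and starts at 0. The exponentials are estimated crudely by 1 and
  \<open>exp L\<close>.\<close>

lemma Gronwall_unit_interval:
  fixes E E' G :: "real \<Rightarrow> real"
  assumes dE: "\<And>x. x \<in> {0..1} \<Longrightarrow> (E has_real_derivative E' x) (at x within {0..1})"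
    and le: "\<And>x. x \<in> {0..1} \<Longrightarrow> E' x \<le> L * E x + G x"
    and G: "continuous_on {0..1} G" "\<And>x. x \<in> {0..1} \<Longrightarrow> 0 \<le> G x"
    and "E 0 = 0" "0 \<le> L" and x: "x \<in> {0..1}"
  shows "E x \<le> exp L * integral {0..1} G"
proof -
  define P where "P x = exp (- L * x) * E x - integral {0..x} G" for x
  have dP: "(P has_real_derivative exp (- L * y) * (E' y - L * E y) - G y) (at y within {0..1})"
    if "y \<in> {0..1}" for y
    unfolding P_def
    by (rule derivative_eq_intros dE[OF that] integral_has_real_derivative[OF G(1) that] refl)+
      (simp add: algebra_simps)
  then have cP: "continuous_on {0..1} P"
    using DERIV_continuous continuous_on_eq_continuous_within by blast
  have "P x \<le> P 0"
  proof (rule DERIV_nonpos_imp_decreasing_open[of 0 x P])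
    show "0 \<le> x" using x by simp
    show "continuous_on {0..x} P"
      by (rule continuous_on_subset[OF cP]) (use x in auto)
    fix y assume y: "0 < y" "y < x"
    have "at y within {0..1} = at y" by (rule at_within_interior) (use y x in auto)
    moreover have "exp (- L * y) * (E' y - L * E y) - G y \<le> 0"
    proof -
      have "exp (- L * y) * (E' y - L * E y) \<le> exp (- L * y) * G y"
        using le[of y] y x by (intro mult_left_mono) auto
      also have "\<dots> \<le> 1 * G y" using G(2)[of y] y x \<open>0 \<le> L\<close> by (intro mult_right_mono) auto
      finally show ?thesis by simp
    qed
    ultimately show "\<exists>d. DERIV P y :> d \<and> d \<le> 0" using dP[of y] y x by auto
  qed
  then have "exp (- L * x) * E x \<le> integral {0..x} G" using \<open>E 0 = 0\<close> by (simp add: P_def)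
  also have "\<dots> \<le> integral {0..1} G"
    using x G by (intro integral_subset_le integrable_continuous_real) (auto intro: continuous_on_subset)
  finally have *: "exp (- L * x) * E x \<le> integral {0..1} G" .
  have "E x = exp (L * x) * (exp (- L * x) * E x)" by (simp flip: exp_add mult.assoc)
  also have "\<dots> \<le> exp (L * x) * integral {0..1} G" using * by (intro mult_left_mono) auto
  also have "\<dots> \<le> exp L * integral {0..1} G"
    using x \<open>0 \<le> L\<close> G by (intro mult_right_mono integral_nonneg integrable_continuous_real)
      (auto simp: mult_left_le)
  finally show ?thesis .
qed

lemma nderiv_nderiv: "nderiv n (nderiv m u) = nderiv (n + m) u"
  by (induction n) simp_all

lemma nderiv_zero_near_0:
  assumes "smooth_I w" "\<And>x. x \<in> {0..1} \<Longrightarrow> x < \<delta> \<Longrightarrow> w x = 0" "x \<in> {0..1}" "x < \<delta>"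
  shows "nderiv n w x = 0"
  using assms(3,4)
proof (induction n arbitrary: x)
  case (Suc n)
  show ?case
    by (rule has_vector_derivative_unique_unit_interval[OF Suc.prems(1)
          smooth_I_has_vector_derivative[OF assms(1) Suc.prems(1)]
          has_vector_derivative_zero_near_0[OF Suc.prems Suc.IH]])
qed (use assms(2) in simp)

text \<open>Gronwall is applied to the squared modulus of \<open>w'\<close>. Beyond \<delta> the
  equation bounds \<open>w''\<close> by \<open>(h + (2 + |s|) |w'|) / \<delta>\<^sup>2\<close>, and
  \<open>2 |w'| h \<le> |w'|\<^sup>2 + h\<^sup>2\<close> adds one more to \<open>4 + 2 |s|\<close>;
  this is the numerator of \<open>L\<close>. Below \<delta> everything on the left is 0.\<close>

lemma first_derivative_energy_bound:
  assumes w: "smooth_I w" and f: "smooth_I f"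
    and W: "\<And>x. x \<in> {0..1} \<Longrightarrow> cmod (W x) \<le> CW"
    and ode: "\<And>x. x \<in> {0..1} \<Longrightarrow>
      of_real x ^ 2 * nderiv 2 w x + (2 * of_real x + s) * nderiv 1 w x = f x + W x * w x"
    and \<delta>: "0 < \<delta>" and w0: "\<And>x. x \<in> {0..1} \<Longrightarrow> x < \<delta> \<Longrightarrow> w x = 0"
    and L: "L = (5 + 2 * cmod s) / \<delta>\<^sup>2"
  shows "integral {0..1} (\<lambda>x. (cmod (nderiv 1 w x))\<^sup>2) \<le> exp L * (2 * L *
    (integral {0..1} (\<lambda>x. (cmod (f x))\<^sup>2) + CW\<^sup>2 * integral {0..1} (\<lambda>x. (cmod (w x))\<^sup>2)))"
proof -
  define v where "v = nderiv 1 w"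
  define v' where "v' = nderiv 2 w"
  define G where "G x = 2 * L * ((cmod (f x))\<^sup>2 + CW\<^sup>2 * (cmod (w x))\<^sup>2)" for x
  have L0: "0 \<le> L" "1 / \<delta>\<^sup>2 \<le> L" unfolding L by (auto intro!: divide_right_mono)
  have cw: "continuous_on {0..1} w" and cf: "continuous_on {0..1} f"
    and cv: "continuous_on {0..1} v"
    using continuous_on_nderiv[OF w, of 0] continuous_on_nderiv[OF f, of 0] continuous_on_nderiv[OF w, of 1]
    by (simp_all add: v_def)
  have dv: "(v has_vector_derivative v' x) (at x within {0..1})" if "x \<in> {0..1}" for x
    using smooth_I_has_vector_derivative[OF w that, of 1] unfolding v_def v'_def by (simp only: Suc_1)
  have vzero: "v x = 0" if "x \<in> {0..1}" "x < \<delta>" for x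
    unfolding v_def by (rule nderiv_zero_near_0[OF w w0 that])
  have E: "(cmod (v x))\<^sup>2 \<le> exp L * integral {0..1} G" if x: "x \<in> {0..1}" for x
  proof (rule Gronwall_unit_interval[where E' = "\<lambda>x. 2 * (v x \<bullet> v' x)", OF _ _ _ _ _ L0(1) x])
    show "((\<lambda>x. (cmod (v x))\<^sup>2) has_real_derivative 2 * (v x \<bullet> v' x)) (at x within {0..1})"
      if "x \<in> {0..1}" for x
      using bounded_bilinear.has_vector_derivative[OF bounded_bilinear_inner dv[OF that] dv[OF that]]
      by (simp add: has_real_derivative_iff_has_vector_derivative power2_norm_eq_inner inner_commute)
    show "continuous_on {0..1} G" unfolding G_def by (intro continuous_intros cf cw)
    show "0 \<le> G x" for x using L0 by (simp add: G_def)
    show "(cmod (v 0))\<^sup>2 = 0" using vzero[of 0] \<delta> by simp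
    fix x :: real assume x: "x \<in> {0..1}"
    show "2 * (v x \<bullet> v' x) \<le> L * (cmod (v x))\<^sup>2 + G x"
    proof (cases "x < \<delta>")
      case True
      then show ?thesis using vzero[OF x True] L0 by (simp add: G_def)
    next
      case False
      define h where "h = cmod (f x) + CW * cmod (w x)"
      have "of_real x ^ 2 * v' x = f x + W x * w x - (2 * of_real x + s) * v x"
        using ode[OF x] by (simp add: v_def v'_def algebra_simps)
      from arg_cong[OF this, of cmod]
      have "x\<^sup>2 * cmod (v' x) = cmod (f x + W x * w x - (2 * of_real x + s) * v x)"
        by (simp add: norm_mult norm_power)
      also have "\<dots> \<le> cmod (f x) + cmod (W x) * cmod (w x) + cmod (2 * of_real x + s) * cmod (v x)"
        using norm_triangle_ineq4[of "f x + W x * w x" "(2 * of_real x + s) * v x"]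
          norm_triangle_ineq[of "f x" "W x * w x"] by (simp add: norm_mult)
      also have "\<dots> \<le> h + (2 + cmod s) * cmod (v x)"
      proof -
        have "cmod (2 * of_real x + s) \<le> 2 + cmod s"
          using norm_triangle_ineq[of "2 * of_real x" s] x by (simp add: norm_mult)
        then show ?thesis unfolding h_def using W[OF x]
          by (intro add_mono mult_right_mono) auto
      qed
      finally have "x\<^sup>2 * cmod (v' x) \<le> h + (2 + cmod s) * cmod (v x)" .
      moreover have "\<delta>\<^sup>2 * cmod (v' x) \<le> x\<^sup>2 * cmod (v' x)"
        using False \<delta> by (intro mult_right_mono power_mono) auto
      ultimately have v': "cmod (v' x) \<le> (h + (2 + cmod s) * cmod (v x)) / \<delta>\<^sup>2"
        using \<delta> by (simp add: pos_le_divide_eq mult.commute)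
      have "2 * (v x \<bullet> v' x) \<le> 2 * cmod (v x) * cmod (v' x)"
        using norm_cauchy_schwarz[of "v x" "v' x"] by simp
      also have "\<dots> \<le> 2 * cmod (v x) * ((h + (2 + cmod s) * cmod (v x)) / \<delta>\<^sup>2)"
        by (rule mult_left_mono[OF v']) simp
      also have "\<dots> = (2 * cmod (v x) * h + (4 + 2 * cmod s) * (cmod (v x))\<^sup>2) / \<delta>\<^sup>2"
        by (simp add: algebra_simps power2_eq_square)
      also have "\<dots> \<le> (h\<^sup>2 + (5 + 2 * cmod s) * (cmod (v x))\<^sup>2) / \<delta>\<^sup>2"
        using sum_squares_bound[of "cmod (v x)" h] by (intro divide_right_mono) (auto simp: algebra_simps)
      also have "\<dots> = L * (cmod (v x))\<^sup>2 + 1 / \<delta>\<^sup>2 * h\<^sup>2"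
        unfolding L by (simp add: add_divide_distrib[of "h\<^sup>2"])
      also have "1 / \<delta>\<^sup>2 * h\<^sup>2 \<le> L * (2 * ((cmod (f x))\<^sup>2 + CW\<^sup>2 * (cmod (w x))\<^sup>2))"
      proof (rule mult_mono[OF L0(2)])
        show "h\<^sup>2 \<le> 2 * ((cmod (f x))\<^sup>2 + CW\<^sup>2 * (cmod (w x))\<^sup>2)"
          using sum_squares_bound[of "cmod (f x)" "CW * cmod (w x)"]
          by (simp add: h_def power2_sum power_mult_distrib)
      qed (use L0 in auto)
      finally show ?thesis by (simp add: G_def algebra_simps)
    qed
  qed
  have "integral {0..1} (\<lambda>x. (cmod (v x))\<^sup>2) \<le> integral {0..1} (\<lambda>x::real. exp L * integral {0..1} G)"
    by (rule integral_le) (use E in \<open>auto intro!: integrable_continuous_real continuous_intros cv\<close>)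
  also have "\<dots> = exp L * integral {0..1} G" by simp
  also have "integral {0..1} G = 2 * L * (integral {0..1} (\<lambda>x. (cmod (f x))\<^sup>2) + CW\<^sup>2 * integral {0..1} (\<lambda>x. (cmod (w x))\<^sup>2))"
  proof -
    have "integral {0..1} (\<lambda>x. (cmod (f x))\<^sup>2 + CW\<^sup>2 * (cmod (w x))\<^sup>2)
      = integral {0..1} (\<lambda>x. (cmod (f x))\<^sup>2) + integral {0..1} (\<lambda>x. CW\<^sup>2 * (cmod (w x))\<^sup>2)"
      by (rule integral_add) (auto intro!: integrable_continuous_real continuous_intros cf cw)
    then show ?thesis unfolding G_def by simp
  qed
  finally show ?thesis unfolding v_def .
qed

section \<open>The weighted estimate\<close>

text \<open>In terms of \<open>z\<^sub>j = \<sigma>\<^sup>j / j!\<^sup>2 |w\<^sup>(\<^sup>j\<^sup>)|\<close> the convolution with the Gevrey coefficient \<open>W\<close>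
  is dominated by a geometric one, because the binomial coefficients are at least 1.\<close>

lemma weighted_recurrence:
  fixes p :: "nat \<Rightarrow> real" and \<sigma> \<sigma>s \<delta> S CW F :: real
  assumes p: "\<And>j. 0 \<le> p j" and pos: "0 < \<sigma>" "0 < \<sigma>s" "0 < \<delta>" "0 \<le> S" "0 \<le> CW" "0 \<le> F"
    and ineq: "\<delta>\<^sup>2 * p (n + 2) \<le> F + (2 * (real n + 1) + S) * p (n + 1) + real n * (real n + 1) * p n +
      (\<Sum>k\<le>n. real (n choose k) * (CW / \<sigma>s ^ k * (fact k)\<^sup>2) * p (n - k))"
    and \<rho>: "\<rho> = \<sigma> / \<sigma>s"
    and y: "\<And>j. y j = (real j + 1) * (\<sigma> ^ j / (fact j)\<^sup>2 * p j)"
    and K: "K = 3 * \<sigma>\<^sup>2 / (2 * \<delta>\<^sup>2) * (1 + (2 + S) / \<sigma> + (1 + CW) / \<rho>)"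
  shows "(real n + 2) * y (n + 2) \<le> K * (\<sigma> ^ n / (fact n * fact (n + 1)) * F + (\<Sum>j\<le>n + 1. \<rho> ^ (n + 1 - j) * y j))"
proof -
  define z where "z j = \<sigma> ^ j / (fact j)\<^sup>2 * p j" for j
  have z0: "0 \<le> z j" for j using p pos by (simp add: z_def)
  have yz: "y j = (real j + 1) * z j" for j by (simp add: y z_def)
  have y0: "0 \<le> y j" for j using z0 by (simp add: yz)
  have zy: "z j \<le> y j" for j using z0 by (simp add: yz distrib_right)
  have \<rho>0: "0 < \<rho>" using pos by (simp add: \<rho>)
  \<comment> \<open>After multiplication by \<open>c\<close>, every term carries or is dominated by
    a factor \<open>N\<^sup>2\<close>, which cancels; what remains on the left is
    \<open>(N + 1)\<^sup>2 z (n + 2)\<close> up to constants.\<close>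
  define c where "c = \<sigma> ^ n / (fact n)\<^sup>2"
  have c0: "0 \<le> c" using pos by (simp add: c_def)
  define N where "N = real n + 1"
  have N: "1 \<le> N" by (simp add: N_def)
  define Fn where "Fn = \<sigma> ^ n / (fact n * fact (n + 1)) * F"
  have Fn0: "0 \<le> Fn" using pos by (simp add: Fn_def)
  define T where "T = (\<Sum>k\<le>n. \<rho> ^ k * y (n - k))"
  have T0: "0 \<le> T" unfolding T_def using \<rho>0 y0 by (intro sum_nonneg) auto
  define M where "M = (\<Sum>j\<le>n + 1. \<rho> ^ (n + 1 - j) * y j)"
  define R where "R = Fn + (2 + S) / \<sigma> * y (n + 1) + y n + CW * T"
  have fact2: "fact (n + 2) = (N + 1) * N * (fact n :: real)" and fact1: "fact (n + 1) = N * (fact n :: real)"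
    by (simp_all add: N_def algebra_simps)
  have t1: "c * p (n + 2) = N\<^sup>2 * ((N + 1)\<^sup>2 / \<sigma>\<^sup>2 * z (n + 2))"
    unfolding c_def z_def fact2 using pos N by (simp add: power_add power_mult_distrib divide_simps power2_eq_square[of \<sigma>])
  have t2: "c * p (n + 1) = N\<^sup>2 / \<sigma> * z (n + 1)"
    unfolding c_def z_def fact1 using pos N by (simp add: power_mult_distrib divide_simps)
  have t3: "c * p n = z n" by (simp add: c_def z_def)
  have t5: "c * F = N * Fn"
    unfolding c_def Fn_def fact1 using N by (simp add: power2_eq_square)
  have t4: "c * (real (n choose k) * (CW / \<sigma>s ^ k * (fact k)\<^sup>2) * p (n - k)) \<le> CW * (\<rho> ^ k * y (n - k))"
    if "k \<le> n" for k
  proof -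
    have ch: "1 \<le> real (n choose k)" using that by (simp add: Suc_leI)
    \<comment> \<open>The factorials \<open>k!\<close>, \<open>(n-k)!\<close> and \<open>n!\<close>
      enter squared and give the inverse square of the binomial coefficient, so one inverse binomial
      coefficient survives.\<close>
    have "c * (real (n choose k) * (CW / \<sigma>s ^ k * (fact k)\<^sup>2) * p (n - k))
        = (CW * (\<rho> ^ k * z (n - k))) / real (n choose k)"
    proof -
      have s: "\<sigma> ^ n = \<sigma> ^ k * \<sigma> ^ (n - k)" using that by (simp flip: power_add)
      show ?thesis using that pos unfolding binomial_fact[OF that] c_def z_def \<rho> s
        by (simp add: field_simps power2_eq_square)
    qed
    also have "\<dots> \<le> CW * (\<rho> ^ k * z (n - k)) / 1"
      using that ch z0 \<rho>0 pos by (intro divide_left_mono) auto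
    also have "\<dots> \<le> CW * (\<rho> ^ k * y (n - k))"
      using zy \<rho>0 pos by (simp add: mult_left_mono)
    finally show ?thesis .
  qed
  have "N\<^sup>2 * (\<delta>\<^sup>2 / \<sigma>\<^sup>2 * ((N + 1)\<^sup>2 * z (n + 2))) = c * (\<delta>\<^sup>2 * p (n + 2))"
    unfolding mult.left_commute[of c] t1 by simp
  also have "\<dots> \<le> c * (F + (2 * N + S) * p (n + 1) + real n * N * p n +
      (\<Sum>k\<le>n. real (n choose k) * (CW / \<sigma>s ^ k * (fact k)\<^sup>2) * p (n - k)))"
    using ineq by (intro mult_left_mono c0) (simp add: N_def)
  also have "\<dots> = N * Fn + (2 * N + S) * (c * p (n + 1)) + real n * N * (c * p n) +
      (\<Sum>k\<le>n. c * (real (n choose k) * (CW / \<sigma>s ^ k * (fact k)\<^sup>2) * p (n - k)))"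
    using t5 by (simp add: sum_distrib_left algebra_simps)
  also have "\<dots> \<le> N\<^sup>2 * Fn + N\<^sup>2 * ((2 + S) / \<sigma> * y (n + 1)) + N\<^sup>2 * y n + N\<^sup>2 * (CW * T)"
  proof (intro add_mono)
    have NN: "N \<le> N\<^sup>2" "1 \<le> N\<^sup>2" using N by (auto simp: power2_eq_square mult_le_cancel_left1 mult_ge1_I)
    show "N * Fn \<le> N\<^sup>2 * Fn" using NN Fn0 by (intro mult_right_mono)
    \<comment> \<open>The additional factor in \<open>y (n + 1) = (N + 1) * z (n + 1)\<close>
      absorbs the linear growth of the coefficient.\<close>
    have "(2 * N + S) * z (n + 1) \<le> ((2 + S) * (N + 1)) * z (n + 1)"
      using N pos z0 by (intro mult_right_mono) (auto simp: algebra_simps mult_le_cancel_left1)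
    then have "(2 * N + S) * z (n + 1) \<le> (2 + S) * y (n + 1)"
      by (simp add: yz N_def algebra_simps)
    then have "N\<^sup>2 / \<sigma> * ((2 * N + S) * z (n + 1)) \<le> N\<^sup>2 / \<sigma> * ((2 + S) * y (n + 1))"
      using pos by (intro mult_left_mono) auto
    then show "(2 * N + S) * (c * p (n + 1)) \<le> N\<^sup>2 * ((2 + S) / \<sigma> * y (n + 1))"
      unfolding t2 by (simp add: mult_ac)
    have "real n * N \<le> N\<^sup>2" by (simp add: N_def power2_eq_square)
    then show "real n * N * (c * p n) \<le> N\<^sup>2 * y n"
      unfolding t3 using zy[of n] z0[of n] by (intro mult_mono) auto
    have "(\<Sum>k\<le>n. c * (real (n choose k) * (CW / \<sigma>s ^ k * (fact k)\<^sup>2) * p (n - k))) \<le> CW * T"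
      unfolding T_def sum_distrib_left by (intro sum_mono t4) simp
    also have "\<dots> \<le> N\<^sup>2 * (CW * T)"
      using mult_right_mono[OF NN(2), of "CW * T"] T0 pos by simp
    finally show "(\<Sum>k\<le>n. c * (real (n choose k) * (CW / \<sigma>s ^ k * (fact k)\<^sup>2) * p (n - k))) \<le> N\<^sup>2 * (CW * T)" .
  qed
  also have "\<dots> = N\<^sup>2 * R" by (simp add: R_def algebra_simps)
  finally have "\<delta>\<^sup>2 / \<sigma>\<^sup>2 * ((N + 1)\<^sup>2 * z (n + 2)) \<le> R"
    by (rule mult_left_le_imp_le) (use N in simp)
  then have main: "(N + 1)\<^sup>2 * z (n + 2) \<le> \<sigma>\<^sup>2 / \<delta>\<^sup>2 * R"
    using pos by (simp add: field_simps)
  have "(real n + 2) * y (n + 2) \<le> 3 / 2 * ((N + 1)\<^sup>2 * z (n + 2))"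
  proof -
    \<comment> \<open>\<open>(N + 2) / (N + 1) \<le> 3 / 2\<close> because \<open>N \<ge> 1\<close>;
      this is the factor 3/2 in \<open>K\<close>.\<close>
    have "(N + 1) * (N + 2) \<le> 3 / 2 * (N + 1)\<^sup>2" using N one_le_power[OF N, of 2]
      by (simp add: power2_eq_square field_simps)
    from mult_right_mono[OF this z0[of "n + 2"]] show ?thesis by (simp add: yz N_def algebra_simps)
  qed
  also have "\<dots> \<le> 3 / 2 * (\<sigma>\<^sup>2 / \<delta>\<^sup>2 * R)"
    by (rule mult_left_mono[OF main]) simp
  also have "\<dots> = 3 * \<sigma>\<^sup>2 / (2 * \<delta>\<^sup>2) * R" by simp
  also have "\<dots> \<le> 3 * \<sigma>\<^sup>2 / (2 * \<delta>\<^sup>2) * ((1 + (2 + S) / \<sigma> + (1 + CW) / \<rho>) * (Fn + M))"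
  proof (rule mult_left_mono)
    \<comment> \<open>All parts of \<open>R\<close> other than \<open>Fn\<close> are compared with
      \<open>M\<close>: \<open>y (n + 1)\<close> is its top term, \<open>T\<close> is at most
      \<open>M / \<rho>\<close> by the index shift, and \<open>y n\<close> is the term
      \<open>k = 0\<close> of \<open>T\<close>. This explains the bracket in
      \<open>K\<close>.\<close>
    have MT: "M = \<rho> * T + y (n + 1)"
    proof -
      have "M = (\<Sum>j\<le>n. \<rho> ^ (n + 1 - j) * y j) + y (n + 1)" by (simp add: M_def)
      also have "(\<Sum>j\<le>n. \<rho> ^ (n + 1 - j) * y j) = (\<Sum>k\<le>n. \<rho> ^ (k + 1) * y (n - k))"
        by (rule sum.reindex_bij_witness[where i = "\<lambda>j. n - j" and j = "\<lambda>j. n - j"]) (auto simp: Suc_diff_le)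
      finally show ?thesis by (simp add: T_def sum_distrib_left mult.assoc)
    qed
    have TM: "T \<le> 1 / \<rho> * M" using MT \<rho>0 y0[of "n + 1"] by (simp add: field_simps)
    have "y n \<le> T"
    proof -
      have "(\<Sum>k\<in>{0}. \<rho> ^ k * y (n - k)) \<le> T"
        unfolding T_def using \<rho>0 y0 by (intro sum_mono2) auto
      then show ?thesis by simp
    qed
    then have "y n + CW * T \<le> (1 + CW) * T" by (simp add: algebra_simps)
    also have "\<dots> \<le> (1 + CW) * (1 / \<rho> * M)" using TM pos by (intro mult_left_mono) auto
    finally have 1: "y n + CW * T \<le> (1 + CW) / \<rho> * M" by simp
    have "y (n + 1) \<le> M" using MT T0 \<rho>0 by simp
    then have 2: "(2 + S) / \<sigma> * y (n + 1) \<le> (2 + S) / \<sigma> * M" using pos by (intro mult_left_mono) auto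
    have "M \<ge> 0" using MT T0 y0[of "n + 1"] \<rho>0 by simp
    moreover have "0 \<le> (2 + S) / \<sigma> * Fn" "0 \<le> (1 + CW) / \<rho> * Fn" using pos \<rho>0 Fn0 by auto
    ultimately show "R \<le> (1 + (2 + S) / \<sigma> + (1 + CW) / \<rho>) * (Fn + M)"
      using 1 2 unfolding R_def by (simp add: distrib_left distrib_right)
  qed (use pos in simp)
  finally show ?thesis by (simp add: K Fn_def M_def mult.assoc)
qed

text \<open>The Gevrey condition controls the open interval only; continuity of the derivatives
  carries the bound to the endpoints.\<close>

lemma gevrey_bound_closed:
  assumes "gevrey \<sigma>s 2 W" "0 < \<sigma>s"
  obtains CW where "0 \<le> CW"
    "\<And>n x. x \<in> {0..1} \<Longrightarrow> cmod (nderiv n W x) \<le> CW / \<sigma>s ^ n * (fact n)\<^sup>2"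
proof -
  obtain C where C: "C > 0"
    "\<And>n x. x \<in> {0<..<1} \<Longrightarrow> cmod (nderiv n W x) \<le> C * \<sigma>s powr (- real n) * (fact n) powr 2"
    and W: "smooth_I W"
    using assms(1) unfolding gevrey_def by blast
  have "cmod (nderiv n W x) \<le> C / \<sigma>s ^ n * (fact n)\<^sup>2" if "x \<in> {0..1}" for n x
  proof (rule continuous_le_on_closure[where S = "{0<..<1}" and f = "\<lambda>x. cmod (nderiv n W x)"])
    have cl: "closure {0<..<1} = {0..1::real}" by simp
    show "x \<in> closure {0<..<1}" using that cl by blast
    show "continuous_on (closure {0<..<1}) (\<lambda>x. cmod (nderiv n W x))"
      unfolding cl by (intro continuous_on_norm continuous_on_nderiv W)
    show "cmod (nderiv n W y) \<le> C / \<sigma>s ^ n * (fact n)\<^sup>2" if "y \<in> {0<..<1}" for y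
      using C(2)[OF that, of n] assms(2) by (simp add: powr_minus powr_realpow divide_inverse)
  qed
  then show ?thesis by (rule that[OF less_imp_le[OF C(1)]])
qed

text \<open>Pointwise, either \<open>x < \<delta>\<close> and the left side is 0, or
  \<open>\<delta>\<^sup>2 \<le> x\<^sup>2\<close> and the weighted recurrence applies. Squaring
  costs 2 for separating \<open>f\<close> from the convolution and \<open>1 / (1 - \<rho>)\<close>
  for Cauchy-Schwarz, which explains the constant.\<close>

lemma integrated_weighted_recurrence:
  fixes \<sigma> \<sigma>s \<delta> CW :: real
  assumes W: "smooth_I W" and f: "smooth_I f" and w: "smooth_I w"
    and bound: "\<And>n x. x \<in> {0..1} \<Longrightarrow> cmod (nderiv n W x) \<le> CW / \<sigma>s ^ n * (fact n)\<^sup>2"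
    and pos: "0 < \<sigma>" "\<sigma> < \<sigma>s" "0 < \<delta>" "0 \<le> CW"
    and ode: "\<And>x. x \<in> {0..1} \<Longrightarrow>
      of_real x ^ 2 * nderiv 2 w x + (2 * of_real x + s) * nderiv 1 w x = f x + W x * w x"
    and w0: "\<And>x. x \<in> {0..1} \<Longrightarrow> x < \<delta> \<Longrightarrow> w x = 0"
    and \<rho>: "\<rho> = \<sigma> / \<sigma>s"
    and Y: "\<And>j. Y j = integral {0..1} (\<lambda>x. ((real j + 1) * (\<sigma> ^ j / (fact j)\<^sup>2 * cmod (nderiv j w x)))\<^sup>2)"
    and K: "K = 3 * \<sigma>\<^sup>2 / (2 * \<delta>\<^sup>2) * (1 + (2 + cmod s) / \<sigma> + (1 + CW) / \<rho>)"
  shows "(real n + 2)\<^sup>2 * Y (n + 2) \<le>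
    2 * K\<^sup>2 / (1 - \<rho>) * (semi_term \<sigma> 0 f n + (\<Sum>j\<le>n + 1. \<rho> ^ (n + 1 - j) * Y j))"
proof -
  define y where "y j x = (real j + 1) * (\<sigma> ^ j / (fact j)\<^sup>2 * cmod (nderiv j w x))" for j x
  define Fn where "Fn x = \<sigma> ^ n / (fact n * fact (n + 1)) * cmod (nderiv n f x)" for x
  have \<rho>01: "0 < \<rho>" "\<rho> < 1" using pos by (auto simp: \<rho>)
  have K0: "0 \<le> K" using pos \<rho>01 by (simp add: K)
  have y0: "0 \<le> y j x" for j x using pos by (simp add: y_def)
  have Fn0: "0 \<le> Fn x" for x using pos by (simp add: Fn_def)
  have cy: "continuous_on {0..1} (y j)" for j
    unfolding y_def by (intro continuous_intros continuous_on_nderiv w)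
  have cF: "continuous_on {0..1} Fn"
    unfolding Fn_def by (intro continuous_intros continuous_on_nderiv f)
  have lin: "(real n + 2) * y (n + 2) x \<le> K * (Fn x + (\<Sum>j\<le>n + 1. \<rho> ^ (n + 1 - j) * y j x))"
    if x: "x \<in> {0..1}" for x
  proof (cases "x < \<delta>")
    case True
    have "y (n + 2) x = 0" unfolding y_def using nderiv_zero_near_0[OF w w0 x True] by (simp del: nderiv.simps)
    moreover have "0 \<le> K * (Fn x + (\<Sum>j\<le>n + 1. \<rho> ^ (n + 1 - j) * y j x))"
      using K0 Fn0[of x] y0 \<rho>01 by (intro mult_nonneg_nonneg add_nonneg_nonneg sum_nonneg) auto
    ultimately show ?thesis by simp
  next
    case False
    let ?p = "\<lambda>j. cmod (nderiv j w x)"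
    have "of_real x ^ 2 * nderiv (n + 2) w x = nderiv n f x
        + (\<Sum>k\<le>n. of_nat (n choose k) * (nderiv k W x * nderiv (n - k) w x))
        - (2 * (of_nat n + 1) * of_real x + s) * nderiv (n + 1) w x
        - of_nat n * (of_nat n + 1) * nderiv n w x" (is "_ = ?f + ?S - ?a - ?b")
      using nderiv_recurrence[OF W f w ode x, of n] by (simp add: algebra_simps del: nderiv.simps)
    from arg_cong[OF this, of cmod]
    have "x\<^sup>2 * ?p (n + 2) = cmod (?f + ?S - ?a - ?b)"
      by (simp add: norm_mult norm_power del: nderiv.simps)
    also have "\<dots> \<le> cmod ?f + cmod ?S + cmod ?a + cmod ?b"
      using norm_triangle_ineq4[of "?f + ?S - ?a" ?b] norm_triangle_ineq4[of "?f + ?S" ?a]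
        norm_triangle_ineq[of ?f ?S] by linarith
    also have "\<dots> \<le> cmod ?f + (2 * (real n + 1) + cmod s) * ?p (n + 1) + real n * (real n + 1) * ?p n
        + (\<Sum>k\<le>n. real (n choose k) * (CW / \<sigma>s ^ k * (fact k)\<^sup>2) * ?p (n - k))"
    proof -
      have "cmod (2 * (of_nat n + 1) * of_real x + s) \<le> 2 * (real n + 1) + cmod s"
      proof -
        have "cmod (2 * (of_nat n + 1) * of_real x) = 2 * (real n + 1) * x"
        proof -
          have "2 * (of_nat n + 1) * of_real x = complex_of_real (2 * (real n + 1) * x)" by simp
          then show ?thesis using x by (simp only: norm_of_real) simp
        qed
        also have "\<dots> \<le> 2 * (real n + 1) * 1" using x by (intro mult_left_mono) auto
        finally show ?thesis
          using norm_triangle_ineq[of "2 * (of_nat n + 1) * of_real x" s] by simp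
      qed
      then have "cmod ?a \<le> (2 * (real n + 1) + cmod s) * ?p (n + 1)"
        unfolding norm_mult by (rule mult_right_mono) simp
      moreover have "cmod ?b = real n * (real n + 1) * ?p n"
      proof -
        have "of_nat n * (of_nat n + 1) = complex_of_real (real n * (real n + 1))" by simp
        then show ?thesis by (simp only: norm_mult norm_of_real) simp
      qed
      moreover have "cmod ?S \<le> (\<Sum>k\<le>n. real (n choose k) * (CW / \<sigma>s ^ k * (fact k)\<^sup>2) * ?p (n - k))"
      proof (rule sum_norm_le)
        fix k
        have "cmod (nderiv k W x) * ?p (n - k) \<le> (CW / \<sigma>s ^ k * (fact k)\<^sup>2) * ?p (n - k)"
          by (rule mult_right_mono[OF bound[OF x]]) simp
        from mult_left_mono[OF this, of "real (n choose k)"]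
        show "cmod (of_nat (n choose k) * (nderiv k W x * nderiv (n - k) w x)) \<le>
            real (n choose k) * (CW / \<sigma>s ^ k * (fact k)\<^sup>2) * ?p (n - k)"
          by (simp add: norm_mult mult.assoc)
      qed
      ultimately show ?thesis by linarith
    qed
    finally have "x\<^sup>2 * ?p (n + 2) \<le> \<dots>" .
    moreover have "\<delta>\<^sup>2 * ?p (n + 2) \<le> x\<^sup>2 * ?p (n + 2)"
      using False pos by (intro mult_right_mono power_mono) auto
    ultimately have "\<delta>\<^sup>2 * ?p (n + 2) \<le> cmod ?f + (2 * (real n + 1) + cmod s) * ?p (n + 1) + real n * (real n + 1) * ?p n
        + (\<Sum>k\<le>n. real (n choose k) * (CW / \<sigma>s ^ k * (fact k)\<^sup>2) * ?p (n - k))" by linarith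
    from weighted_recurrence[OF _ pos(1) _ pos(3) _ pos(4) _ this \<rho> y_def K]
    show ?thesis unfolding Fn_def using pos by simp
  qed
  have sq: "(real n + 2)\<^sup>2 * (y (n + 2) x)\<^sup>2 \<le>
      2 * K\<^sup>2 / (1 - \<rho>) * ((Fn x)\<^sup>2 + (\<Sum>j\<le>n + 1. \<rho> ^ (n + 1 - j) * (y j x)\<^sup>2))" if x: "x \<in> {0..1}" for x
  proof -
    let ?M = "\<Sum>j\<le>n + 1. \<rho> ^ (n + 1 - j) * y j x" and ?Q = "\<Sum>j\<le>n + 1. \<rho> ^ (n + 1 - j) * (y j x)\<^sup>2"
    have "(real n + 2)\<^sup>2 * (y (n + 2) x)\<^sup>2 = ((real n + 2) * y (n + 2) x)\<^sup>2" by (simp add: power_mult_distrib)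
    also have "\<dots> \<le> (K * (Fn x + ?M))\<^sup>2"
      by (rule power_mono[OF lin[OF x]]) (use y0 in simp)
    also have "\<dots> = K\<^sup>2 * (Fn x + ?M)\<^sup>2" by (simp add: power_mult_distrib)
    also have "\<dots> \<le> K\<^sup>2 * (2 * ((Fn x)\<^sup>2 / (1 - \<rho>) + 1 / (1 - \<rho>) * ?Q))"
    proof (rule mult_left_mono)
      have "(a + b)\<^sup>2 \<le> 2 * (a\<^sup>2 + b\<^sup>2)" for a b :: real
        using sum_squares_bound[of a b] by (simp add: power2_sum)
      then have "(Fn x + ?M)\<^sup>2 \<le> 2 * ((Fn x)\<^sup>2 + ?M\<^sup>2)" .
      \<comment> \<open>The term of \<open>f\<close> is enlarged so that both terms share the factor
        \<open>1 / (1 - \<rho>)\<close>.\<close>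
      also have "(Fn x)\<^sup>2 \<le> (Fn x)\<^sup>2 / (1 - \<rho>)"
        using \<rho>01 by (simp add: pos_le_divide_eq mult_left_le)
      also have "?M\<^sup>2 \<le> 1 / (1 - \<rho>) * ?Q"
        by (rule geometric_sum_square_le) (use \<rho>01 in auto)
      finally show "(Fn x + ?M)\<^sup>2 \<le> 2 * ((Fn x)\<^sup>2 / (1 - \<rho>) + 1 / (1 - \<rho>) * ?Q)" by simp
    qed simp
    also have "\<dots> = 2 * K\<^sup>2 / (1 - \<rho>) * ((Fn x)\<^sup>2 + ?Q)"
      by (simp add: distrib_left mult_ac del: sum.atMost_Suc)
    finally show ?thesis .
  qed
  have iy: "(\<lambda>x. (y j x)\<^sup>2) integrable_on {0..1}" for j
    by (intro integrable_continuous_real continuous_intros cy)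
  have iF: "(\<lambda>x. (Fn x)\<^sup>2) integrable_on {0..1}"
    by (intro integrable_continuous_real continuous_intros cF)
  have iQ: "(\<lambda>x. \<Sum>j\<le>n + 1. \<rho> ^ (n + 1 - j) * (y j x)\<^sup>2) integrable_on {0..1}"
    by (intro integrable_sum integrable_on_mult_right iy) simp
  have Yy: "Y j = integral {0..1} (\<lambda>x. (y j x)\<^sup>2)" for j by (simp add: Y y_def)
  have "(real n + 2)\<^sup>2 * Y (n + 2) = integral {0..1} (\<lambda>x. (real n + 2)\<^sup>2 * (y (n + 2) x)\<^sup>2)"
    by (simp add: Yy)
  also have "\<dots> \<le> integral {0..1} (\<lambda>x. 2 * K\<^sup>2 / (1 - \<rho>) *
      ((Fn x)\<^sup>2 + (\<Sum>j\<le>n + 1. \<rho> ^ (n + 1 - j) * (y j x)\<^sup>2)))"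
    by (intro integral_le integrable_on_mult_right integrable_add iy iF iQ sq)
  also have "\<dots> = 2 * K\<^sup>2 / (1 - \<rho>) * (integral {0..1} (\<lambda>x. (Fn x)\<^sup>2) +
      integral {0..1} (\<lambda>x. \<Sum>j\<le>n + 1. \<rho> ^ (n + 1 - j) * (y j x)\<^sup>2))"
    using integral_add[OF iF iQ] by (simp only: integral_mult_right)
  also have "integral {0..1} (\<lambda>x. \<Sum>j\<le>n + 1. \<rho> ^ (n + 1 - j) * (y j x)\<^sup>2) = (\<Sum>j\<le>n + 1. \<rho> ^ (n + 1 - j) * Y j)"
    unfolding Yy by (subst integral_sum) (auto intro!: integrable_on_mult_right iy)
  also have "integral {0..1} (\<lambda>x. (Fn x)\<^sup>2) = semi_term \<sigma> 0 f n"
    unfolding semi_term_def Fn_def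
    by (simp add: power_mult_distrib power_divide power_mult power2_eq_square mult_ac del: fact_Suc
        flip: power_mult_distrib)
  finally show ?thesis .
qed

lemma semi_term_nonneg:
  assumes "0 < \<sigma>" "smooth_I u" shows "0 \<le> semi_term \<sigma> k u n"
  unfolding semi_term_def using assms
  by (intro mult_nonneg_nonneg integral_nonneg integrable_continuous_real continuous_intros continuous_on_nderiv)
    auto

text \<open>Order \<open>n\<close> of \<open>w'\<close> is order \<open>n + 1\<close> of
  \<open>w\<close>. After this shift the two squared weights differ by \<sigma>^2 and a ratio of at
  least 1, while the factors \<open>n^k\<close> and \<open>(x/\<sigma>)^k\<close> are estimated by
  their largest case \<open>k = 2\<close>.\<close>

lemma semi_term_nderiv_le:
  assumes \<sigma>: "0 < \<sigma>" and w: "smooth_I w" and k: "k \<le> 2"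
    and Y: "Y = integral {0..1} (\<lambda>x. ((real (n + 1) + 1) * (\<sigma> ^ (n + 1) / (fact (n + 1))\<^sup>2 * cmod (nderiv (n + 1) w x)))\<^sup>2)"
  shows "semi_term \<sigma> k (nderiv 1 w) n \<le> (1 + 1 / \<sigma>) ^ 2 / \<sigma>\<^sup>2 * ((real (n + 1))\<^sup>2 * Y)"
proof -
  define A where "A = \<sigma> ^ (2 * n) / ((fact n)\<^sup>2 * (fact (n + 1))\<^sup>2)"
  define g where "g x = (cmod (nderiv (n + 1) w x))\<^sup>2" for x
  have A0: "0 \<le> A" using \<sigma> by (simp add: A_def)
  have cg: "continuous_on {0..1} g" unfolding g_def
    by (intro continuous_intros continuous_on_nderiv w)
  have g0: "0 \<le> integral {0..1} g"
    by (intro integral_nonneg integrable_continuous_real cg) (simp add: g_def)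
  have "integral {0..1} (\<lambda>x. (x / \<sigma>) ^ k * g x) \<le> integral {0..1} (\<lambda>x. (1 / \<sigma>) ^ k * g x)"
  proof (rule integral_le)
    show "(\<lambda>x. (x / \<sigma>) ^ k * g x) integrable_on {0..1}" "(\<lambda>x. (1 / \<sigma>) ^ k * g x) integrable_on {0..1}"
      using \<sigma> by (intro integrable_continuous_real continuous_intros cg; simp)+
    show "(x / \<sigma>) ^ k * g x \<le> (1 / \<sigma>) ^ k * g x" if "x \<in> {0..1}" for x
      using that \<sigma> by (intro mult_right_mono power_mono divide_right_mono) (auto simp: g_def)
  qed
  also have "\<dots> = (1 / \<sigma>) ^ k * integral {0..1} g" by simp
  also have "\<dots> \<le> (1 + 1 / \<sigma>) ^ 2 * integral {0..1} g"
  proof (rule mult_right_mono[OF _ g0])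
    \<comment> \<open>\<open>1 / \<sigma>\<close> may lie on either side of 1; the base
      \<open>1 + 1 / \<sigma>\<close> is monotone in the exponent in both cases.\<close>
    have "(1 / \<sigma>) ^ k \<le> (1 + 1 / \<sigma>) ^ k" using \<sigma> by (intro power_mono) auto
    also have "\<dots> \<le> (1 + 1 / \<sigma>) ^ 2" using \<sigma> k by (intro power_increasing) auto
    finally show "(1 / \<sigma>) ^ k \<le> (1 + 1 / \<sigma>) ^ 2" .
  qed
  finally have int: "integral {0..1} (\<lambda>x. (x / \<sigma>) ^ k * g x) \<le> (1 + 1 / \<sigma>) ^ 2 * integral {0..1} g" .
  have pk: "real n ^ k \<le> (real (n + 1))\<^sup>2"
  proof -
    have "real n ^ k \<le> real (n + 1) ^ k" by (intro power_mono) auto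
    also have "\<dots> \<le> (real (n + 1))\<^sup>2" using k by (intro power_increasing) auto
    finally show ?thesis .
  qed
  have "semi_term \<sigma> k (nderiv 1 w) n = A * real n ^ k * integral {0..1} (\<lambda>x. (x / \<sigma>) ^ k * g x)"
    unfolding semi_term_def A_def g_def nderiv_nderiv ..
  also have "\<dots> \<le> A * (real (n + 1))\<^sup>2 * ((1 + 1 / \<sigma>) ^ 2 * integral {0..1} g)"
  proof (intro mult_mono[OF _ int] mult_left_mono pk A0)
    show "0 \<le> integral {0..1} (\<lambda>x. (x / \<sigma>) ^ k * g x)"
      using \<sigma> by (intro integral_nonneg integrable_continuous_real continuous_intros cg) (auto simp: g_def)
  qed (use A0 in simp)
  also have "\<dots> = (1 + 1 / \<sigma>) ^ 2 * (real (n + 1))\<^sup>2 * (A * integral {0..1} g)" by simp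
  also have "\<dots> \<le> (1 + 1 / \<sigma>) ^ 2 * (real (n + 1))\<^sup>2 * (Y / \<sigma>\<^sup>2)"
  proof (rule mult_left_mono)
    define N where "N = real n + 1"
    have N: "1 \<le> N" by (simp add: N_def)
    have fact1: "fact (n + 1) = N * (fact n :: real)" by (simp add: N_def)
    have "Y = (\<sigma> ^ (n + 1) / (fact (n + 1))\<^sup>2)\<^sup>2 * (N + 1)\<^sup>2 * integral {0..1} g"
    proof -
      have "((real (n + 1) + 1) * (a * q))\<^sup>2 = (a\<^sup>2 * (N + 1)\<^sup>2) * q\<^sup>2" for a q :: real
        by (simp add: power_mult_distrib N_def mult_ac add_ac)
      then show ?thesis unfolding Y g_def by (simp only: integral_mult_right)
    qed
    moreover have "(\<sigma> ^ (n + 1) / (fact (n + 1))\<^sup>2)\<^sup>2 * (N + 1)\<^sup>2 = A * \<sigma>\<^sup>2 * ((N + 1) / N)\<^sup>2"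
      unfolding A_def fact1 using \<sigma> N
      by (simp add: power_mult_distrib power_divide power2_eq_square power_add power_mult divide_simps mult_ac)
    ultimately have Yeq: "Y / \<sigma>\<^sup>2 = ((N + 1) / N)\<^sup>2 * (A * integral {0..1} g)" using \<sigma> by simp
    have "1 \<le> ((N + 1) / N)\<^sup>2" using N by (intro one_le_power) simp
    then show "A * integral {0..1} g \<le> Y / \<sigma>\<^sup>2"
      unfolding Yeq using mult_right_mono[of 1 "((N + 1) / N)\<^sup>2" "A * integral {0..1} g"] A0 g0 by simp
  qed simp
  finally show ?thesis by (simp add: mult_ac)
qed

text \<open>The recursion needs two initial values: \<open>Y 0\<close> is the squared L2 norm of
  \<open>w\<close>, and \<open>Y 1\<close> is controlled by the energy bound. The constant is
  obtained before \<open>w\<close>, \<open>f\<close> and \<open>k\<close>, as the uniformity in the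
  theorem requires.\<close>

lemma a_priori_estimate:
  fixes \<sigma> \<sigma>s \<delta> :: real and s :: complex
  assumes gev: "gevrey \<sigma>s 2 W" and pos: "0 < \<sigma>" "\<sigma> < \<sigma>s" "0 < \<delta>"
  obtains C where "0 \<le> C" "\<And>w f k. \<lbrakk>smooth_I w; smooth_I f; summable (semi_term \<sigma> 0 f); k \<le> 2;
      \<And>x. x \<in> {0..1} \<Longrightarrow> of_real x ^ 2 * nderiv 2 w x + (2 * of_real x + s) * nderiv 1 w x = f x + W x * w x;
      \<And>x. x \<in> {0..1} \<Longrightarrow> x < \<delta> \<Longrightarrow> w x = 0\<rbrakk>
    \<Longrightarrow> summable (semi_term \<sigma> k (nderiv 1 w)) \<and>
      suminf (semi_term \<sigma> k (nderiv 1 w)) \<le> C * (suminf (semi_term \<sigma> 0 f) + integral {0..1} (\<lambda>x. (cmod (w x))\<^sup>2))"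
proof -
  have \<sigma>s: "0 < \<sigma>s" using pos by simp
  have W: "smooth_I W" using gev by (simp add: gevrey_def)
  obtain CW where CW: "0 \<le> CW"
    "\<And>n x. x \<in> {0..1} \<Longrightarrow> cmod (nderiv n W x) \<le> CW / \<sigma>s ^ n * (fact n)\<^sup>2"
    using gevrey_bound_closed[OF gev \<sigma>s] by blast
  define \<rho> where "\<rho> = \<sigma> / \<sigma>s"
  have \<rho>: "0 \<le> \<rho>" "\<rho> < 1" using pos by (auto simp: \<rho>_def)
  define K where "K = 3 * \<sigma>\<^sup>2 / (2 * \<delta>\<^sup>2) * (1 + (2 + cmod s) / \<sigma> + (1 + CW) / \<rho>)"
  have K: "0 \<le> 2 * K\<^sup>2 / (1 - \<rho>)" using \<rho> by simp
  define L where "L = (5 + 2 * cmod s) / \<delta>\<^sup>2"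
  have L: "0 \<le> L" by (simp add: L_def)
  \<comment> \<open>\<open>4 * \<sigma>\<^sup>2\<close> is the weight of order 1 in
    \<open>Y\<close>, and the rest comes from the energy bound; its two data terms are merged by the
    factor \<open>1 + CW\<^sup>2\<close>.\<close>
  define E where "E = 4 * \<sigma>\<^sup>2 * (exp L * (2 * L * (1 + CW\<^sup>2)))"
  have E: "0 \<le> E" using L by (simp add: E_def)
  define D where "D = (1 + 1 / \<sigma>) ^ 2 / \<sigma>\<^sup>2"
  have D: "0 \<le> D" by (simp add: D_def)
  show ?thesis
  proof (rule geometric_convolution_summable[OF \<rho> K], goal_cases)
    case (1 C1)
    note C1 = 1(1) and C1b = 1(2)
    show ?thesis
    proof (rule that[of "D * (C1 * (1 + E))"])
      show "0 \<le> D * (C1 * (1 + E))" using D C1 E by simp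
      fix w f :: "real \<Rightarrow> complex" and k :: nat
      assume w: "smooth_I w" and f: "smooth_I f" and sf: "summable (semi_term \<sigma> 0 f)" and k: "k \<le> 2"
        and ode: "\<And>x. x \<in> {0..1} \<Longrightarrow>
          of_real x ^ 2 * nderiv 2 w x + (2 * of_real x + s) * nderiv 1 w x = f x + W x * w x"
        and w0: "\<And>x. x \<in> {0..1} \<Longrightarrow> x < \<delta> \<Longrightarrow> w x = 0"
      define Y where "Y j = integral {0..1} (\<lambda>x. ((real j + 1) * (\<sigma> ^ j / (fact j)\<^sup>2 * cmod (nderiv j w x)))\<^sup>2)" for j
      define \<Phi> where "\<Phi> = semi_term \<sigma> 0 f"
      define U where "U = integral {0..1} (\<lambda>x. (cmod (w x))\<^sup>2)"
      have Y0: "0 \<le> Y j" for j unfolding Y_def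
        by (intro integral_nonneg integrable_continuous_real continuous_intros continuous_on_nderiv w) simp
      have \<Phi>0: "0 \<le> \<Phi> n" for n unfolding \<Phi>_def by (rule semi_term_nonneg[OF pos(1) f])
      have sums: "summable (\<lambda>n. (real n)\<^sup>2 * Y n) \<and> (\<Sum>n. (real n)\<^sup>2 * Y n) \<le> C1 * (suminf \<Phi> + Y 0 + Y 1)"
      proof (rule C1b[OF Y0 \<Phi>0])
        show "summable \<Phi>" using sf by (simp add: \<Phi>_def)
        show "(real n + 2)\<^sup>2 * Y (n + 2) \<le> 2 * K\<^sup>2 / (1 - \<rho>) * (\<Phi> n + (\<Sum>j\<le>n + 1. \<rho> ^ (n + 1 - j) * Y j))" for n
          unfolding \<Phi>_def
          by (rule integrated_weighted_recurrence[OF W f w CW(2) pos CW(1) ode w0 \<rho>_def Y_def K_def])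
      qed
      note sum = sums[THEN conjunct1] sums[THEN conjunct2]
      have YU: "Y 0 = U" by (simp add: Y_def U_def)
      then have U0: "0 \<le> U" using Y0[of 0] by simp
      have \<Phi>le: "\<Phi> 0 \<le> suminf \<Phi>"
        using sum_le_suminf[of \<Phi> "{0}"] sf \<Phi>0 by (simp add: \<Phi>_def)
      have "Y 1 \<le> E * (suminf \<Phi> + U)"
      proof -
        have "((real 1 + 1) * (\<sigma> ^ 1 / (fact 1)\<^sup>2 * q))\<^sup>2 = 4 * \<sigma>\<^sup>2 * q\<^sup>2" for q :: real
          by (simp add: power_mult_distrib)
        then have "Y 1 = 4 * \<sigma>\<^sup>2 * integral {0..1} (\<lambda>x. (cmod (nderiv 1 w x))\<^sup>2)"
          unfolding Y_def by (simp only: integral_mult_right)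
        also have "\<dots> \<le> 4 * \<sigma>\<^sup>2 * (exp L * (2 * L * (integral {0..1} (\<lambda>x. (cmod (f x))\<^sup>2) + CW\<^sup>2 * U)))"
          unfolding U_def
          by (intro mult_left_mono first_derivative_energy_bound[OF w f _ ode pos(3) w0 L_def])
            (use CW(2)[of _ 0] in auto)
        also have "\<dots> \<le> 4 * \<sigma>\<^sup>2 * (exp L * (2 * L * ((1 + CW\<^sup>2) * (suminf \<Phi> + U))))"
        proof (intro mult_left_mono)
          have "integral {0..1} (\<lambda>x. (cmod (f x))\<^sup>2) = \<Phi> 0" by (simp add: \<Phi>_def semi_term_def)
          moreover have "0 \<le> CW\<^sup>2 * suminf \<Phi>" using \<Phi>le \<Phi>0[of 0] by simp
          ultimately show "integral {0..1} (\<lambda>x. (cmod (f x))\<^sup>2) + CW\<^sup>2 * U \<le> (1 + CW\<^sup>2) * (suminf \<Phi> + U)"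
            using \<Phi>le U0 by (simp add: algebra_simps)
        qed (use L in auto)
        finally show ?thesis by (simp add: E_def mult.assoc)
      qed
      then have "C1 * (suminf \<Phi> + Y 0 + Y 1) \<le> C1 * ((1 + E) * (suminf \<Phi> + U))"
        unfolding YU using C1 by (intro mult_left_mono) (auto simp: algebra_simps)
      then have tot: "(\<Sum>n. (real n)\<^sup>2 * Y n) \<le> C1 * (1 + E) * (suminf \<Phi> + U)" using sum(2) by simp
      have shift: "summable (\<lambda>n. (real (n + 1))\<^sup>2 * Y (n + 1))"
        "(\<Sum>n. (real (n + 1))\<^sup>2 * Y (n + 1)) = (\<Sum>n. (real n)\<^sup>2 * Y n)"
        using summable_ignore_initial_segment[OF sum(1), of 1] suminf_split_head[OF sum(1)] by auto
      have le: "semi_term \<sigma> k (nderiv 1 w) n \<le> D * ((real (n + 1))\<^sup>2 * Y (n + 1))" for n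
        unfolding D_def by (rule semi_term_nderiv_le[OF pos(1) w k Y_def])
      have w1: "smooth_I (nderiv 1 w)"
        unfolding smooth_I_iff using smooth_I_imp_times_differentiable_on[OF w] by blast
      have sm: "summable (semi_term \<sigma> k (nderiv 1 w))"
        by (rule summable_comparison_test'[OF summable_mult[OF shift(1), of D], of 0])
          (use le semi_term_nonneg[OF pos(1) w1] in \<open>simp add: abs_of_nonneg\<close>)
      have "suminf (semi_term \<sigma> k (nderiv 1 w)) \<le> (\<Sum>n. D * ((real (n + 1))\<^sup>2 * Y (n + 1)))"
        by (rule suminf_le[OF le sm summable_mult[OF shift(1)]])
      also have "\<dots> = D * (\<Sum>n. (real n)\<^sup>2 * Y n)"
        using suminf_mult[OF shift(1), of D] shift(2) by simp
      also have "\<dots> \<le> D * (C1 * (1 + E) * (suminf \<Phi> + U))" using tot D by (rule mult_left_mono)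
      finally show "summable (semi_term \<sigma> k (nderiv 1 w)) \<and>
        suminf (semi_term \<sigma> k (nderiv 1 w)) \<le>
          D * (C1 * (1 + E)) * (suminf (semi_term \<sigma> 0 f) + integral {0..1} (\<lambda>x. (cmod (w x))\<^sup>2))"
        using sm by (simp add: \<Phi>_def U_def mult.assoc)
    qed
  qed
qed

section \<open>The continuous representative and the final estimate\<close>

lemma continuous_AE_zero_imp_zero:
  fixes w :: "real \<Rightarrow> complex"
  assumes cont: "continuous_on {0..1} w" and ae: "AE x in lebesgue. x \<in> {0<..<m} \<longrightarrow> w x = 0"
    and m: "0 < m" "m \<le> 1" and x: "x \<in> {0..m}"
  shows "w x = 0"
proof -
  obtain N where N: "N \<in> null_sets lebesgue" "{x \<in> space lebesgue. \<not> (x \<in> {0<..<m} \<longrightarrow> w x = 0)} \<subseteq> N"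
    using ae unfolding eventually_ae_filter by blast
  let ?Z = "{0<..<m} \<inter> w -` (- {0})"
  have "open ?Z"
    using cont m by (intro continuous_open_preimage) (auto intro: continuous_on_subset)
  moreover have "negligible ?Z"
    by (rule negligible_subset[of N]) (use N in \<open>auto simp: negligible_iff_null_sets\<close>)
  \<comment> \<open>A nonempty open set has positive measure; this upgrades vanishing almost
    everywhere to vanishing everywhere.\<close>
  ultimately have "?Z = {}" using open_not_negligible by blast
  then have z: "w y = 0" if "y \<in> {0<..<m}" for y using that by auto
  have cl: "closure {0<..<m} = {0..m}" using m by simp
  show ?thesis
    by (rule continuous_constant_on_closure[of "{0<..<m}" w 0 x])
      (use z x cl m cont in \<open>auto intro: continuous_on_subset\<close>)
qed

theorem mainTheorem15:
  fixes W :: "real \<Rightarrow> complex" and \<sigma>s \<sigma> \<delta> :: real and s :: complex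
  assumes "gevrey \<sigma>s 2 W" and "0 < \<sigma>" and "\<sigma> < \<sigma>s" and "0 < \<delta>"
  shows "\<exists>C. \<forall>u f.
    H2_I u \<and> (AE x in lebesgue. x \<in> {0<..<\<delta>} \<longrightarrow> u x = 0) \<and> trace_zero_at_1 u \<and>
    in_Y \<sigma> f \<and> L_op_eq s W u f \<longrightarrow>
    (\<exists>w. in_X \<sigma> w \<and> (AE x in lebesgue. x \<in> {0<..<1} \<longrightarrow> w x = u x) \<and>
         norm_X \<sigma> w \<le> C * (norm_Y \<sigma> f + L2_norm u))"
proof (rule a_priori_estimate[OF assms, where s = s], goal_cases)
  case (1 C)
  note C = 1(1) and est = 1(2)
  \<comment> \<open>The factor 3 counts the seminorms with \<open>k = 0, 1, 2\<close>, each with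
    square at most \<open>C * R\<close>; the trace part is 0 because all derivatives of
    \<open>w\<close> vanish at 0.\<close>
  have "\<exists>w. in_X \<sigma> w \<and> (AE x in lebesgue. x \<in> {0<..<1} \<longrightarrow> w x = u x) \<and>
         norm_X \<sigma> w \<le> sqrt (3 * C) * (norm_Y \<sigma> f + L2_norm u)"
    if H2: "H2_I u" and u0: "AE x in lebesgue. x \<in> {0<..<\<delta>} \<longrightarrow> u x = 0" and tr: "trace_zero_at_1 u"
      and Y: "in_Y \<sigma> f" and eq: "L_op_eq s W u f" for u f
  proof -
    obtain w where cw: "continuous_on {0..1} w" and ae: "AE x in lebesgue. x \<in> {0<..<1} \<longrightarrow> w x = u x"
      and w1: "w 1 = 0" using tr unfolding trace_zero_at_1_def by blast
    have f: "smooth_I f" and sf: "summable (semi_term \<sigma> 0 f)"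
      using Y by (auto simp: in_Y_def)
    have W: "smooth_I W" using assms(1) by (simp add: gevrey_def)
    have w0: "w x = 0" if "x \<in> {0..1}" "x < \<delta>" for x
    proof (rule continuous_AE_zero_imp_zero[OF cw, of "min \<delta> 1"])
      show "AE x in lebesgue. x \<in> {0<..<min \<delta> 1} \<longrightarrow> w x = 0"
        using ae u0 by eventually_elim auto
    qed (use that assms in auto)
    note w = weak_solution_smooth[OF W f cw ae eq assms(4) w0]
    define R where "R = suminf (semi_term \<sigma> 0 f) + integral {0..1} (\<lambda>x. (cmod (w x))\<^sup>2)"
    have semi: "summable (semi_term \<sigma> k (nderiv 1 w))" "(semi_norm \<sigma> k (nderiv 1 w))\<^sup>2 \<le> C * R" if "k \<le> 2" for k
    proof -
      have *: "summable (semi_term \<sigma> k (nderiv 1 w)) \<and> suminf (semi_term \<sigma> k (nderiv 1 w)) \<le> C * R"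
        unfolding R_def by (rule est[OF w(1) f sf that w(2) w0])
      moreover have "smooth_I (nderiv 1 w)"
        unfolding smooth_I_iff using smooth_I_imp_times_differentiable_on[OF w(1)] by blast
      ultimately show "summable (semi_term \<sigma> k (nderiv 1 w))" "(semi_norm \<sigma> k (nderiv 1 w))\<^sup>2 \<le> C * R"
        using semi_term_nonneg[OF assms(2)] by (auto simp: semi_norm_def suminf_nonneg simp del: nderiv.simps)
    qed
    have "nderiv n (nderiv 1 w) 0 = 0" for n
      unfolding nderiv_nderiv by (rule nderiv_zero_near_0[OF w(1) w0]) (use assms(4) in auto)
    then have trace: "trace_term \<sigma> (nderiv 1 w) = (\<lambda>n. 0)"
      unfolding trace_term_def by (simp del: nderiv.simps)
    then have trace0: "trace_norm \<sigma> (nderiv 1 w) = 0" by (simp add: trace_norm_def)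
    have X: "in_X \<sigma> w"
      unfolding in_X_def trace using w(1) w1 semi(1)[of 0] semi(1)[of 1] semi(1)[of 2] by simp
    have f2: "suminf (semi_term \<sigma> 0 f) \<le> (norm_Y \<sigma> f)\<^sup>2"
      using semi_term_nonneg[OF assms(2) f] sf
      by (simp add: norm_Y_def semi_norm_def suminf_nonneg)
    have u2: "integral {0..1} (\<lambda>x. (cmod (w x))\<^sup>2) = (L2_norm u)\<^sup>2"
    proof -
      have "(LINT x:{0<..<1}|lebesgue. (cmod (u x))\<^sup>2) = integral {0..1} (\<lambda>x. (cmod (w x))\<^sup>2)"
        by (rule set_lebesgue_integral_eq_integral_AE)
          (use H2 ae in \<open>auto simp: H2_I_def L2_I_def elim!: eventually_mono\<close>)
      moreover have "0 \<le> integral {0..1} (\<lambda>x. (cmod (w x))\<^sup>2)"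
        by (intro integral_nonneg integrable_continuous_real continuous_intros cw) simp
      ultimately show ?thesis by (simp add: L2_norm_def)
    qed
    have "norm_X \<sigma> w \<le> sqrt (3 * C * ((norm_Y \<sigma> f)\<^sup>2 + (L2_norm u)\<^sup>2))"
    proof -
      have "R \<le> (norm_Y \<sigma> f)\<^sup>2 + (L2_norm u)\<^sup>2" using f2 u2 by (simp add: R_def)
      then have "C * R \<le> C * ((norm_Y \<sigma> f)\<^sup>2 + (L2_norm u)\<^sup>2)" using C by (rule mult_left_mono)
      then show ?thesis
        unfolding norm_X_def trace0 using semi(2)[of 0] semi(2)[of 1] semi(2)[of 2]
        by (simp del: nderiv.simps)
    qed
    also have "\<dots> = sqrt (3 * C) * sqrt ((norm_Y \<sigma> f)\<^sup>2 + (L2_norm u)\<^sup>2)" by (rule real_sqrt_mult)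
    also have "\<dots> \<le> sqrt (3 * C) * (norm_Y \<sigma> f + L2_norm u)"
    proof (rule mult_left_mono)
      have "0 \<le> norm_Y \<sigma> f" by (simp add: norm_Y_def)
      moreover have "0 \<le> L2_norm u"
        unfolding L2_norm_def set_lebesgue_integral_def by (intro real_sqrt_ge_zero integral_nonneg_AE) simp
      ultimately show "sqrt ((norm_Y \<sigma> f)\<^sup>2 + (L2_norm u)\<^sup>2) \<le> norm_Y \<sigma> f + L2_norm u"
        by (rule sqrt_sum_squares_le_sum)
    qed (use C in simp)
    finally show ?thesis using X ae by blast
  qed
  then show ?thesis by blast
qed

end
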